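(* Let $L_0>0$ and consider a spike and slab prior $\pi$ on $\ell^2(\Lambda)$ as defined in the context, whose weights satisfy in addition $w_{j,n}\le n^{-6}2^{-j(1+\tau)}$ for all $j\le J_n$, with $\tau>1/2$. Let $\widehat\theta$ be the Bayes estimator $$\widehat\theta\in\operatorname*{argmin}_{\delta}\,E^\pi\big[\ell_\infty(\delta,\theta)\mid Y^n\big]$$ (assumed to be well defined). If $Y^n$ is drawn from the Gaussian white noise sequence model, then for any $0<\beta_1\le\beta_2$ and $0<L\le L_0-1$ there exists $M>0$ such that, with $\epsilon_n(\beta)=M(n/\log n)^{-\beta/(2\beta+1)}$, $$\sup_{\beta\in[\beta_1,\beta_2]}\ \sup_{\theta_0\in\mathcal H(\beta,L)}P^n_{\theta_0}\big(\ell_\infty(\widehat\theta,\theta_0)\ge\epsilon_n(\beta)\big)=o(1)\qquad(n\to\infty)$$ and $$\limsup_{n\to\infty}\ \sup_{\beta\in[\beta_1,\beta_2]}\epsilon_n(\beta)^{-1}\sup_{\theta_0\in\mathcal H(\beta,L)}E^n_{\theta_0}\big[\ell_\infty(\widehat\theta,\theta_0)\big]<\infty.$$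
   Context: Index set: $\Lambda=\{(j,k): j\in\mathbb N=\{0,1,2,\dots\},\ k\in I_j\}$, where the $I_j$ are finite sets with $|I_j|$ of order $2^j$ (i.e. $c_12^j\le|I_j|\le c_22^j$ for fixed constants $0<c_1\le c_2$); $\Lambda$ indexes a compactly supported orthonormal wavelet basis of $L^2([0,1])$. The parameter space is $\ell^2(\Lambda)$. Gaussian white noise sequence model: under $P^n_{\theta}$, $\theta=(\theta_{j,k})\in\ell^2(\Lambda)$, one observes $Y^n=(Y_{j,k})_{(j,k)\in\Lambda}$ with $Y_{j,k}=\theta_{j,k}+n^{-1/2}\epsilon_{j,k}$, the $\epsilon_{j,k}$ being i.i.d. $\mathcal N(0,1)$. $E^n_\theta$ is the corresponding expectation, and $E^\pi[\cdot\mid Y^n]$ denotes expectation over $\theta$ under the posterior distribution. Loss: $\ell_\infty(\theta,\theta')=\sum_{j\in\mathbb N}2^{j/2}\max_{k\in I_j}|\theta_{j,k}-\theta'_{j,k}|$. Hölder balls: $\mathcal H(\beta,L)=\{\theta:\ |\theta_{j,k}|\le L2^{-j(\beta+1/2)}\ \text{for all }(j,k)\in\Lambda\}$, $\beta,L>0$. Spike and slab prior: let $g$ be a bounded probability density on $\mathbb R$ with $\inf_{x\in[-L_0,L_0]}g(x)>0$. Set $J_n=\lfloor\log n/\log 2\rfloor$. Under $\pi$ (which depends on $n$) the $\theta_{j,k}$ are independent; for $j\le J_n$, $k\in I_j$, $\theta_{j,k}$ has law $\pi_j(dx)=(1-w_{j,n})\delta_0(dx)+w_{j,n}g(x)\,dx$,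 and for $j>J_n$, $\theta_{j,k}=0$. It is assumed that there are constants $K>0$, $\tau>1/2$ with $n^{-K}\le w_{j,n}\le 2^{-j(1+\tau)}$ for all $j\le J_n$. *)

theory Defs
  imports "HOL-Probability.Probability"
begin

text \<open>A sequence \<open>\<theta> = (\<theta>\<^sub>j\<^sub>,\<^sub>k)\<close> is a function on pairs \<open>(j, k)\<close>; the index set
  \<open>\<Lambda>\<close> is determined by the level sets \<open>I j\<close>.\<close>

definition Lam :: "(nat \<Rightarrow> 'k set) \<Rightarrow> (nat \<times> 'k) set" where
  "Lam I = (SIGMA j:UNIV. I j)"

definition ell2 :: "(nat \<Rightarrow> 'k set) \<Rightarrow> (nat \<times> 'k \<Rightarrow> real) set" where
  "ell2 I = {\<theta> \<in> Lam I \<rightarrow>\<^sub>E UNIV. (\<lambda>i. (\<theta> i)\<^sup>2) summable_on Lam I}"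

abbreviation seq_space :: "(nat \<Rightarrow> 'k set) \<Rightarrow> (nat \<times> 'k \<Rightarrow> real) measure" where
  "seq_space I \<equiv> PiM (Lam I) (\<lambda>_. borel)"

text \<open>The third argument of \<^const>\<open>normal_density\<close> is the point, the second the standard deviation.\<close>

definition white_noise ::
  "(nat \<Rightarrow> 'k set) \<Rightarrow> nat \<Rightarrow> (nat \<times> 'k \<Rightarrow> real) \<Rightarrow> (nat \<times> 'k \<Rightarrow> real) measure" where
  "white_noise I n \<theta> =
     PiM (Lam I) (\<lambda>i. density lborel (\<lambda>x. ennreal (normal_density (\<theta> i) (1 / sqrt (real n)) x)))"

text \<open>The loss takes values in \<open>[0, \<infinity>]\<close>, since the series may diverge on \<open>\<ell>\<^sup>2(\<Lambda>)\<close>.\<close>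

definition loss ::
  "(nat \<Rightarrow> 'k set) \<Rightarrow> (nat \<times> 'k \<Rightarrow> real) \<Rightarrow> (nat \<times> 'k \<Rightarrow> real) \<Rightarrow> ennreal" where
  "loss I \<theta> \<theta>' =
     (\<Sum>j. ennreal (2 powr (real j / 2) * Max ((\<lambda>k. \<bar>\<theta> (j, k) - \<theta>' (j, k)\<bar>) ` I j)))"

definition holder_ball ::
  "(nat \<Rightarrow> 'k set) \<Rightarrow> real \<Rightarrow> real \<Rightarrow> (nat \<times> 'k \<Rightarrow> real) set" where
  "holder_ball I \<beta> L =
     {\<theta> \<in> ell2 I. \<forall>(j, k) \<in> Lam I. \<bar>\<theta> (j, k)\<bar> \<le> L * 2 powr (- real j * (\<beta> + 1 / 2))}"

definition max_level :: "nat \<Rightarrow> nat" where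
  "max_level n = nat \<lfloor>ln (real n) / ln 2\<rfloor>"

text \<open>The mixture \<open>(1 - w) \<delta>\<^sub>0 + w g(x) dx\<close>; see \<open>emeasure_spike_slab\<close>.\<close>

definition spike_slab :: "real \<Rightarrow> (real \<Rightarrow> real) \<Rightarrow> real measure" where
  "spike_slab w g = measure_pmf (bernoulli_pmf w) \<bind>
     (\<lambda>b. if b then density lborel (\<lambda>x. ennreal (g x)) else return borel 0)"

lemma emeasure_spike_slab:
  assumes "0 \<le> w" "w \<le> 1" and [measurable]: "g \<in> borel_measurable borel"
    and "(\<integral>\<^sup>+x. ennreal (g x) \<partial>lborel) = 1" and "A \<in> sets borel"
  shows "emeasure (spike_slab w g) A =
    ennreal (1 - w) * indicator A 0 + ennreal w * (\<integral>\<^sup>+x\<in>A. ennreal (g x) \<partial>lborel)"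
proof -
  have "prob_space (density lborel (\<lambda>x. ennreal (g x)))"
    by (rule prob_spaceI) (simp add: emeasure_density assms)
  then have "density lborel (\<lambda>x. ennreal (g x)) \<in> space (subprob_algebra borel)"
    by (simp add: space_subprob_algebra prob_space_imp_subprob_space)
  moreover have "return borel 0 \<in> space (subprob_algebra (borel :: real measure))"
    by (simp add: space_subprob_algebra prob_space_imp_subprob_space prob_space_return)
  ultimately have "(\<lambda>b. if b then density lborel (\<lambda>x. ennreal (g x)) else return borel 0)
      \<in> measurable (measure_pmf (bernoulli_pmf w)) (subprob_algebra borel)"
    by (auto simp: measurable_def)
  from emeasure_bind[OF _ this] assms show ?thesis
    by (simp add: spike_slab_def emeasure_density ac_simps)
qed

text \<open>\<open>w j n\<close> is the weight \<open>w\<^sub>j\<^sub>,\<^sub>n\<close>.\<close>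

definition prior ::
  "(nat \<Rightarrow> 'k set) \<Rightarrow> (nat \<Rightarrow> nat \<Rightarrow> real) \<Rightarrow> (real \<Rightarrow> real) \<Rightarrow> nat \<Rightarrow> (nat \<times> 'k \<Rightarrow> real) measure" where
  "prior I w g n =
     PiM (Lam I) (\<lambda>(j, k). if j \<le> max_level n then spike_slab (w j n) g else return borel 0)"

text \<open>The likelihood is the Cameron--Martin density of \<open>white_noise I n \<theta>\<close> with respect to
  \<open>white_noise I n 0\<close>, namely \<open>exp (n \<langle>y, \<theta>\<rangle> - n \<parallel>\<theta>\<parallel>\<^sup>2 / 2)\<close>. The prior charges only
  sequences vanishing above level \<open>max_level n\<close>, for which both series are finite sums; hence the
  posterior given by Bayes' formula is defined for every data sequence \<open>y\<close>.\<close>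

definition likelihood ::
  "(nat \<Rightarrow> 'k set) \<Rightarrow> nat \<Rightarrow> (nat \<times> 'k \<Rightarrow> real) \<Rightarrow> (nat \<times> 'k \<Rightarrow> real) \<Rightarrow> real" where
  "likelihood I n \<theta> y =
     exp (real n * (\<Sum>j. \<Sum>k\<in>I j. y (j, k) * \<theta> (j, k)) - real n / 2 * (\<Sum>j. \<Sum>k\<in>I j. (\<theta> (j, k))\<^sup>2))"

definition posterior ::
  "(nat \<Rightarrow> 'k set) \<Rightarrow> (nat \<times> 'k \<Rightarrow> real) measure \<Rightarrow> nat \<Rightarrow> (nat \<times> 'k \<Rightarrow> real)
     \<Rightarrow> (nat \<times> 'k \<Rightarrow> real) measure" where
  "posterior I \<pi> n y = density \<pi>
     (\<lambda>\<theta>. ennreal (likelihood I n \<theta> y) / (\<integral>\<^sup>+\<theta>'. ennreal (likelihood I n \<theta>' y) \<partial>\<pi>))"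

definition posterior_risk ::
  "(nat \<Rightarrow> 'k set) \<Rightarrow> (nat \<times> 'k \<Rightarrow> real) measure \<Rightarrow> nat \<Rightarrow> (nat \<times> 'k \<Rightarrow> real)
     \<Rightarrow> (nat \<times> 'k \<Rightarrow> real) \<Rightarrow> ennreal" where
  "posterior_risk I \<pi> n y \<delta> = (\<integral>\<^sup>+\<theta>. loss I \<delta> \<theta> \<partial>posterior I \<pi> n y)"

text \<open>The minimization property is only required almost surely, under every law of the model.\<close>

definition bayes_estimator ::
  "(nat \<Rightarrow> 'k set) \<Rightarrow> (nat \<times> 'k \<Rightarrow> real) measure \<Rightarrow> nat
     \<Rightarrow> ((nat \<times> 'k \<Rightarrow> real) \<Rightarrow> (nat \<times> 'k \<Rightarrow> real)) \<Rightarrow> bool" where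
  "bayes_estimator I \<pi> n T \<longleftrightarrow>
     T \<in> measurable (seq_space I) (seq_space I) \<and>
     (\<forall>\<theta>\<in>ell2 I. AE y in white_noise I n \<theta>.
        is_arg_min (posterior_risk I \<pi> n y) (\<lambda>\<delta>. \<delta> \<in> ell2 I) (T y))"

definition rate :: "real \<Rightarrow> nat \<Rightarrow> real \<Rightarrow> real" where
  "rate M n \<beta> = M * (real n / ln (real n)) powr (- \<beta> / (2 * \<beta> + 1))"

end

theory Submission imports Defs begin

text \<open>Let \<open>\<theta>0\<close> be the true parameter and \<open>T\<close> the Bayes estimator. Since \<open>\<theta>0\<close> is itself a candidate in the
  minimization, the triangle inequality gives
  \<open>loss I T \<theta>0 \<le> 2 * posterior_risk I \<pi> n y \<theta>0\<close> (\<open>loss_bayes_le\<close>). It remains to control the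
  posterior mean distance to \<open>\<theta>0\<close>.

  At level \<open>j\<close> the maximum over \<open>k\<close> is bounded by a threshold \<open>t j\<close> plus the sum over \<open>k\<close> of the excesses
  \<open>max 0 (\<bar>\<theta> (j, k) - \<theta>0 (j, k)\<bar> - t j)\<close> (\<open>loss_le_excess\<close>). The threshold is at most a constant times the
  smaller of the noise level \<open>sqrt (ln n / n)\<close> and the bound \<open>L * 2 powr (- j * (\<beta> + 1 / 2))\<close> on the
  coefficients. Weighted by \<open>2 powr (j / 2)\<close>, these two quantities are geometric in \<open>j\<close>, one
  increasing and one decreasing, so their minimum sums to the order of the rate
  \<open>(n / ln n) powr (- \<beta> / (2 * \<beta> + 1))\<close> (\<open>suminf_min_powr_le\<close>).

  The excesses depend on one coordinate each, and the posterior of a coordinate is determined by its own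
  observation (\<open>nn_integral_posterior_coordinate\<close>). Their mean under the data law is, by Fubini, an
  integral over the prior of the averaged posterior density \<open>\<phi> x = E (lik x y / Z y)\<close>, where \<open>lik\<close> is
  the likelihood of a coordinate and \<open>Z\<close> the marginal likelihood. If \<open>Z y \<ge> c * lik z y\<close> for all \<open>y\<close>,
  then a Gaussian integral gives \<open>\<phi> x \<le> exp (- n * (x - z) * (z - m)) / c\<close>, with \<open>m\<close> the true
  coefficient (\<open>expected_post_le\<close>). Two choices of \<open>z\<close> are enough. Taking \<open>z\<close> at distance \<open>t / 2\<close> from
  \<open>m\<close> towards \<open>x\<close>, with the slab providing the lower bound on \<open>Z\<close>, shows that values farther than \<open>t\<close>
  from \<open>m\<close> have posterior mass exponentially small in \<open>n t\<^sup>2\<close>; with \<open>t\<close> a large multiple of the noise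
  level this is any prescribed power of \<open>1 / n\<close>. Taking \<open>z = 0\<close>, with the spike providing the lower
  bound, shows that for small coefficients the slab is hardly charged at all, because its
  prior weight is below \<open>n powr (- 6)\<close>. Hence each excess has mean of order \<open>n powr (- 4)\<close>
  (\<open>expected_excess_le\<close>), and their weighted sum has mean of order \<open>1 / n\<close>. That is smaller than every
  rate under consideration by a factor tending to 0, so Markov's inequality yields the convergence in
  probability and the same bound yields the one in mean.\<close>

section \<open>The averaged posterior of one coordinate\<close>

text \<open>The likelihood of one coordinate, relative to the law \<open>N(0, 1/n)\<close>.\<close>

definition coord_lik :: "nat \<Rightarrow> real \<Rightarrow> real \<Rightarrow> real" where
  "coord_lik n x y = exp (real n * (y * x - x\<^sup>2 / 2))"

abbreviation noise :: "nat \<Rightarrow> real \<Rightarrow> real measure" where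
  "noise n m \<equiv> density lborel (\<lambda>y. ennreal (normal_density m (1 / sqrt (real n)) y))"

definition evidence :: "nat \<Rightarrow> real measure \<Rightarrow> real \<Rightarrow> ennreal" where
  "evidence n \<mu> y = (\<integral>\<^sup>+x. ennreal (coord_lik n x y) \<partial>\<mu>)"

text \<open>For a product prior the posterior has independent coordinates, each obtained from its own
  observation; this is the posterior mean of \<open>f\<close> under the prior \<open>\<mu>\<close>.\<close>

definition coord_post :: "nat \<Rightarrow> real measure \<Rightarrow> (real \<Rightarrow> ennreal) \<Rightarrow> real \<Rightarrow> ennreal" where
  "coord_post n \<mu> f y = (\<integral>\<^sup>+x. f x * ennreal (coord_lik n x y) \<partial>\<mu>) / evidence n \<mu> y"

text \<open>The density, with respect to the prior \<open>\<mu>\<close>, of the posterior averaged over the data when the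
  true parameter is \<open>m\<close>.\<close>

definition expected_post :: "nat \<Rightarrow> real measure \<Rightarrow> real \<Rightarrow> real \<Rightarrow> ennreal" where
  "expected_post n \<mu> m x = (\<integral>\<^sup>+y. ennreal (coord_lik n x y) / evidence n \<mu> y \<partial>noise n m)"

lemma coord_lik_pos: "0 < coord_lik n x y"
  by (simp add: coord_lik_def)

lemma coord_lik_0 [simp]: "coord_lik n 0 y = 1"
  by (simp add: coord_lik_def)

lemma coord_lik_le: "coord_lik n x y \<le> exp (real n * y\<^sup>2 / 2)"
proof -
  have "y * x - x\<^sup>2 / 2 \<le> y\<^sup>2 / 2"
    using zero_le_power2[of "x - y"] by (simp add: power2_eq_square algebra_simps)
  then have "real n * (y * x - x\<^sup>2 / 2) \<le> real n * (y\<^sup>2 / 2)"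
    by (rule mult_left_mono) simp
  then show ?thesis
    by (simp add: coord_lik_def)
qed

lemma measurable_coord_lik [measurable]:
  "(\<lambda>(x, y). coord_lik n x y) \<in> borel_measurable (borel \<Otimes>\<^sub>M borel)"
  unfolding coord_lik_def by measurable

lemma measurable_evidence [measurable]:
  assumes "prob_space \<mu>" and [measurable_cong]: "sets \<mu> = sets borel"
  shows "evidence n \<mu> \<in> borel_measurable borel"
proof -
  interpret prob_space \<mu> by fact
  show ?thesis
    unfolding evidence_def by measurable
qed

lemma evidence_pos:
  assumes "prob_space \<mu>" and [measurable_cong]: "sets \<mu> = sets borel"
  shows "0 < evidence n \<mu> y"
proof -
  interpret prob_space \<mu> by fact
  have "\<not> (AE x in \<mu>. ennreal (coord_lik n x y) = 0)"
    using coord_lik_pos by (simp add: not_le[symmetric] ennreal_eq_0_iff)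
  then have "evidence n \<mu> y \<noteq> 0"
    unfolding evidence_def by (subst nn_integral_0_iff_AE) auto
  then show ?thesis
    by (simp add: zero_less_iff_neq_zero)
qed

lemma evidence_finite:
  assumes "prob_space \<mu>"
  shows "evidence n \<mu> y < \<infinity>"
proof -
  interpret prob_space \<mu> by fact
  have "evidence n \<mu> y \<le> (\<integral>\<^sup>+x. ennreal (exp (real n * y\<^sup>2 / 2)) \<partial>\<mu>)"
    unfolding evidence_def by (intro nn_integral_mono ennreal_leI coord_lik_le)
  also have "\<dots> < \<infinity>"
    by (simp add: emeasure_space_1)
  finally show ?thesis .
qed

lemma prob_space_noise: "1 \<le> n \<Longrightarrow> prob_space (noise n m)"
  by (rule prob_space_normal_density) simp

lemma nn_integral_normal_density:
  assumes "0 < \<sigma>"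
  shows "(\<integral>\<^sup>+y. ennreal (normal_density m \<sigma> y) \<partial>lborel) = 1"
proof -
  interpret prob_space "density lborel (\<lambda>y. ennreal (normal_density m \<sigma> y))"
    using assms by (rule prob_space_normal_density)
  show ?thesis
    using emeasure_space_1 by (simp add: emeasure_density)
qed

text \<open>Tilting \<open>N(m, 1/n)\<close> by a likelihood ratio shifts its mean to \<open>m + x - z\<close>. The factor that
  comes out is small as soon as \<open>z\<close> separates \<open>x\<close> from \<open>m\<close>.\<close>

lemma nn_integral_coord_lik_ratio:
  assumes "1 \<le> n"
  shows "(\<integral>\<^sup>+y. ennreal (coord_lik n x y / coord_lik n z y) \<partial>noise n m)
    = ennreal (exp (- real n * (x - z) * (z - m)))"
proof -
  define \<sigma> where "\<sigma> = 1 / sqrt (real n)"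
  have \<sigma>: "0 < \<sigma>" "\<sigma>\<^sup>2 = 1 / real n"
    using assms by (auto simp: \<sigma>_def power_divide)
  have *: "normal_density m \<sigma> y * (coord_lik n x y / coord_lik n z y)
      = exp (- real n * (x - z) * (z - m)) * normal_density (m + x - z) \<sigma> y" for y
  proof -
    have "- (y - m)\<^sup>2 / (2 * \<sigma>\<^sup>2) + (real n * (y * x - x\<^sup>2 / 2) - real n * (y * z - z\<^sup>2 / 2))
      = - real n * (x - z) * (z - m) + - (y - (m + x - z))\<^sup>2 / (2 * \<sigma>\<^sup>2)"
      using assms unfolding \<sigma> by (simp add: power2_eq_square field_simps)
    then show ?thesis
      unfolding normal_density_def coord_lik_def
      by (simp add: exp_diff[symmetric] exp_add[symmetric] mult.assoc mult.left_commute[of "exp _" "1 / _"])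
  qed
  have "(\<integral>\<^sup>+y. ennreal (coord_lik n x y / coord_lik n z y) \<partial>noise n m)
    = (\<integral>\<^sup>+y. ennreal (normal_density m \<sigma> y * (coord_lik n x y / coord_lik n z y)) \<partial>lborel)"
    by (subst nn_integral_density) (simp_all add: \<sigma>_def ennreal_mult'[symmetric])
  also have "\<dots> = (\<integral>\<^sup>+y. ennreal (exp (- real n * (x - z) * (z - m))) *
      ennreal (normal_density (m + x - z) \<sigma> y) \<partial>lborel)"
    unfolding * by (simp add: ennreal_mult'')
  also have "\<dots> = ennreal (exp (- real n * (x - z) * (z - m)))"
    using \<sigma> by (subst nn_integral_cmult) (auto simp: nn_integral_normal_density)
  finally show ?thesis .
qed

text \<open>This is how a lower bound on the marginal likelihood becomes an upper bound on the posterior. The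
  comparison point \<open>z\<close> is free but the same for all \<open>y\<close>, so the mean over the data is a single Gaussian
  integral and no case distinction on the observation arises.\<close>

lemma expected_post_le:
  assumes "1 \<le> n" and "0 < c"
    and ev: "\<And>y. ennreal (c * coord_lik n z y) \<le> evidence n \<mu> y"
  shows "expected_post n \<mu> m x \<le> ennreal (exp (- real n * (x - z) * (z - m)) / c)"
proof -
  have "expected_post n \<mu> m x \<le> (\<integral>\<^sup>+y. ennreal (1 / c) * ennreal (coord_lik n x y / coord_lik n z y) \<partial>noise n m)"
    unfolding expected_post_def
  proof (intro nn_integral_mono)
    fix y
    define r where "r = ennreal (1 / c) * ennreal (coord_lik n x y / coord_lik n z y)"
    have "ennreal (coord_lik n x y) = ennreal (c * coord_lik n z y) * r"
      using coord_lik_pos[of n x y] coord_lik_pos[of n z y] \<open>0 < c\<close>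
      by (simp add: r_def ennreal_mult'[symmetric])
    also have "\<dots> \<le> evidence n \<mu> y * r"
      by (intro mult_right_mono ev) simp
    finally have "ennreal (coord_lik n x y) / evidence n \<mu> y \<le> r"
      using coord_lik_pos[of n z y] \<open>0 < c\<close> ev[of y]
      by (intro divide_le_posI_ennreal) (auto intro: less_le_trans[rotated])
    then show "ennreal (coord_lik n x y) / evidence n \<mu> y
      \<le> ennreal (1 / c) * ennreal (coord_lik n x y / coord_lik n z y)"
      by (simp add: r_def)
  qed
  also have "\<dots> = ennreal (1 / c) * ennreal (exp (- real n * (x - z) * (z - m)))"
    by (subst nn_integral_cmult) (simp_all add: nn_integral_coord_lik_ratio[OF \<open>1 \<le> n\<close>])
  finally show ?thesis
    using \<open>0 < c\<close> by (simp add: ennreal_mult'[symmetric])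
qed

lemma measurable_expected_post [measurable]:
  assumes "1 \<le> n" "prob_space \<mu>" "sets \<mu> = sets borel"
  shows "expected_post n \<mu> m \<in> borel_measurable borel"
proof -
  interpret prob_space "noise n m" using \<open>1 \<le> n\<close> by (rule prob_space_noise)
  note measurable_evidence[OF assms(2,3), measurable]
  show ?thesis
    unfolding expected_post_def by measurable
qed

lemma measurable_coord_post [measurable]:
  assumes "prob_space \<mu>" and [measurable_cong]: "sets \<mu> = sets borel"
    and [measurable]: "f \<in> borel_measurable borel"
  shows "coord_post n \<mu> f \<in> borel_measurable borel"
proof -
  interpret prob_space \<mu> by fact
  note measurable_evidence[OF assms(1,2), measurable]
  show ?thesis
    unfolding coord_post_def by measurable
qed

text \<open>Exchanging the integrals over data and parameter is what lets every later estimate be done for a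
  fixed parameter value \<open>x\<close>.\<close>

lemma nn_integral_coord_post:
  assumes n: "1 \<le> n" and "prob_space \<mu>" and [measurable_cong]: "sets \<mu> = sets borel"
    and [measurable]: "f \<in> borel_measurable borel"
  shows "(\<integral>\<^sup>+y. coord_post n \<mu> f y \<partial>noise n m) = (\<integral>\<^sup>+x. f x * expected_post n \<mu> m x \<partial>\<mu>)"
proof -
  interpret N: prob_space "noise n m" using n by (rule prob_space_noise)
  interpret M: prob_space \<mu> by fact
  interpret P: pair_sigma_finite \<mu> "noise n m" ..
  note measurable_evidence[OF assms(2,3), measurable]
  have "(\<integral>\<^sup>+y. coord_post n \<mu> f y \<partial>noise n m)
    = (\<integral>\<^sup>+y. \<integral>\<^sup>+x. f x * (ennreal (coord_lik n x y) / evidence n \<mu> y) \<partial>\<mu> \<partial>noise n m)"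
    unfolding coord_post_def
    by (intro nn_integral_cong, subst nn_integral_divide[symmetric])
       (auto simp: ennreal_times_divide)
  also have "\<dots> = (\<integral>\<^sup>+x. \<integral>\<^sup>+y. f x * (ennreal (coord_lik n x y) / evidence n \<mu> y) \<partial>noise n m \<partial>\<mu>)"
    by (rule P.Fubini') measurable
  also have "\<dots> = (\<integral>\<^sup>+x. f x * expected_post n \<mu> m x \<partial>\<mu>)"
    unfolding expected_post_def by (intro nn_integral_cong nn_integral_cmult) measurable
  finally show ?thesis .
qed

section \<open>Spike and slab priors in one coordinate\<close>

lemma measurable_spike_slab_kernel:
  fixes g :: "real \<Rightarrow> real"
  assumes [measurable]: "g \<in> borel_measurable borel" and "(\<integral>\<^sup>+x. ennreal (g x) \<partial>lborel) = 1"
  shows "(\<lambda>b. if b then density lborel (\<lambda>x. ennreal (g x)) else return borel 0)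
      \<in> measurable (measure_pmf (bernoulli_pmf w)) (subprob_algebra borel)"
proof -
  have "prob_space (density lborel (\<lambda>x. ennreal (g x)))"
    by (rule prob_spaceI) (simp add: emeasure_density assms)
  then have "density lborel (\<lambda>x. ennreal (g x)) \<in> space (subprob_algebra borel)"
    by (simp add: space_subprob_algebra prob_space_imp_subprob_space)
  moreover have "return borel 0 \<in> space (subprob_algebra (borel :: real measure))"
    by (simp add: space_subprob_algebra prob_space_imp_subprob_space prob_space_return)
  ultimately show ?thesis
    by (auto simp: measurable_def)
qed

lemma sets_spike_slab:
  assumes "g \<in> borel_measurable borel" and "(\<integral>\<^sup>+x. ennreal (g x) \<partial>lborel) = 1"
  shows "sets (spike_slab w g) = sets borel"
  unfolding spike_slab_def
  by (rule sets_bind[OF sets_kernel[OF measurable_spike_slab_kernel[OF assms]]]) auto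

lemma prob_space_spike_slab:
  assumes "0 \<le> w" "w \<le> 1" and "g \<in> borel_measurable borel"
    and "(\<integral>\<^sup>+x. ennreal (g x) \<partial>lborel) = 1"
  shows "prob_space (spike_slab w g)"
proof (rule prob_spaceI)
  have "space (spike_slab w g) = UNIV"
    using sets_eq_imp_space_eq[OF sets_spike_slab[OF assms(3,4)]] by simp
  then show "emeasure (spike_slab w g) (space (spike_slab w g)) = 1"
    using assms by (simp add: emeasure_spike_slab ennreal_plus[symmetric] del: ennreal_plus)
qed

lemma nn_integral_spike_slab:
  assumes "0 \<le> w" "w \<le> 1" and [measurable]: "g \<in> borel_measurable borel"
    and "(\<integral>\<^sup>+x. ennreal (g x) \<partial>lborel) = 1" and [measurable]: "f \<in> borel_measurable borel"
  shows "(\<integral>\<^sup>+x. f x \<partial>spike_slab w g)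
    = ennreal (1 - w) * f 0 + ennreal w * (\<integral>\<^sup>+x. ennreal (g x) * f x \<partial>lborel)"
  unfolding spike_slab_def using assms
  by (subst nn_integral_bind[OF _ measurable_spike_slab_kernel])
     (auto simp: nn_integral_density nn_integral_return mult.commute add.commute)

lemma spike_le_evidence:
  assumes "0 \<le> w" "w \<le> 1" and [measurable]: "g \<in> borel_measurable borel"
    and "(\<integral>\<^sup>+x. ennreal (g x) \<partial>lborel) = 1"
  shows "ennreal (1 - w) \<le> evidence n (spike_slab w g) y"
  unfolding evidence_def using assms
  by (subst nn_integral_spike_slab) auto

text \<open>Moving from \<open>z\<close> towards \<open>y\<close> increases the likelihood up to the factor coming from the quadratic
  term. So one of the two intervals of length \<open>\<delta>\<close> with endpoint \<open>z\<close>, the one on the side of \<open>y\<close>,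
  already carries the bound.\<close>

lemma slab_le_evidence:
  assumes w: "0 \<le> w" "w \<le> 1" and [measurable]: "g \<in> borel_measurable borel"
    and g: "(\<integral>\<^sup>+x. ennreal (g x) \<partial>lborel) = 1" and "0 \<le> g0"
    and g0: "\<And>x. \<bar>x\<bar> \<le> R \<Longrightarrow> g0 \<le> g x" and "0 \<le> \<delta>" and "\<bar>z\<bar> + \<delta> \<le> R"
  shows "ennreal (w * g0 * \<delta> * exp (- real n * \<delta>\<^sup>2 / 2) * coord_lik n z y)
    \<le> evidence n (spike_slab w g) y"
proof -
  define S where "S = (if z \<le> y then {z..z + \<delta>} else {z - \<delta>..z})"
  have S: "emeasure lborel S = ennreal \<delta>" "S \<in> sets borel"
    using \<open>0 \<le> \<delta>\<close> by (auto simp: S_def)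
  define c where "c = g0 * (exp (- real n * \<delta>\<^sup>2 / 2) * coord_lik n z y)"
  have c: "0 \<le> c"
    using \<open>0 \<le> g0\<close> coord_lik_pos[of n z y] by (simp add: c_def)
  have le: "ennreal c * indicator S x \<le> ennreal (g x) * ennreal (coord_lik n x y)" for x
  proof (cases "x \<in> S")
    case True
    then have x: "\<bar>x - z\<bar> \<le> \<delta>" "0 \<le> (y - z) * (x - z)"
      using \<open>0 \<le> \<delta>\<close> by (auto simp: S_def zero_le_mult_iff split: if_splits)
    then have "g0 \<le> g x"
      using \<open>\<bar>z\<bar> + \<delta> \<le> R\<close> by (intro g0) linarith
    have "(x - z)\<^sup>2 \<le> \<delta>\<^sup>2"
      using x(1) \<open>0 \<le> \<delta>\<close> by (simp add: abs_le_square_iff[symmetric])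
    with x(2) have "- \<delta>\<^sup>2 / 2 + (y * z - z\<^sup>2 / 2) \<le> y * x - x\<^sup>2 / 2"
      by (simp add: power2_eq_square algebra_simps)
    then have "real n * (- \<delta>\<^sup>2 / 2 + (y * z - z\<^sup>2 / 2)) \<le> real n * (y * x - x\<^sup>2 / 2)"
      by (rule mult_left_mono) simp
    then have "exp (- real n * \<delta>\<^sup>2 / 2) * coord_lik n z y \<le> coord_lik n x y"
      by (simp add: coord_lik_def exp_add[symmetric] algebra_simps)
    then have "c \<le> g x * coord_lik n x y"
      unfolding c_def using \<open>g0 \<le> g x\<close> \<open>0 \<le> g0\<close> coord_lik_pos[of n z y]
      by (intro mult_mono) auto
    then show ?thesis
      using True \<open>g0 \<le> g x\<close> \<open>0 \<le> g0\<close> by (simp add: ennreal_mult'[symmetric] ennreal_leI)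
  qed simp
  have "ennreal (w * g0 * \<delta> * exp (- real n * \<delta>\<^sup>2 / 2) * coord_lik n z y)
      = ennreal w * (\<integral>\<^sup>+x. ennreal c * indicator S x \<partial>lborel)"
    using S w c \<open>0 \<le> \<delta>\<close> by (subst nn_integral_cmult_indicator) (simp_all add: ennreal_mult'[symmetric] c_def ac_simps)
  also have "\<dots> \<le> ennreal w * (\<integral>\<^sup>+x. ennreal (g x) * ennreal (coord_lik n x y) \<partial>lborel)"
    by (intro mult_left_mono nn_integral_mono le) simp
  also have "\<dots> \<le> evidence n (spike_slab w g) y"
    unfolding evidence_def using w g by (subst nn_integral_spike_slab) auto
  finally show ?thesis .
qed

text \<open>Compare with the spike, that is with \<open>z = 0\<close>.\<close>

lemma expected_post_spike_slab_null:
  assumes "1 \<le> n" "0 \<le> w" "w < 1" "g \<in> borel_measurable borel"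
    and "(\<integral>\<^sup>+x. ennreal (g x) \<partial>lborel) = 1"
  shows "expected_post n (spike_slab w g) m x \<le> ennreal (exp (real n * x * m) / (1 - w))"
  using expected_post_le[of n "1 - w" 0 "spike_slab w g" m x] spike_le_evidence[of w g n] assms
  by simp

text \<open>Compare with the slab near the point \<open>z\<close> at distance \<open>t / 2\<close> from the truth \<open>m\<close> in the direction
  of \<open>x\<close>. Values \<open>x\<close> beyond distance \<open>t\<close> then lose a factor exponential in \<open>n t\<^sup>2\<close>.\<close>

lemma expected_post_spike_slab_signal:
  assumes n: "1 \<le> n" and w: "0 < w" "w \<le> 1" and g: "g \<in> borel_measurable borel"
    "(\<integral>\<^sup>+x. ennreal (g x) \<partial>lborel) = 1" and "0 < g0"
    and g0: "\<And>x. \<bar>x\<bar> \<le> R \<Longrightarrow> g0 \<le> g x"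
    and t: "0 \<le> t" "\<bar>m\<bar> + t / 2 + 1 / sqrt (real n) \<le> R"
  shows "expected_post n (spike_slab w g) m x
    \<le> ennreal (exp (1 / 2) * sqrt (real n) / (w * g0) * exp (- real n * (t / 2) * (\<bar>x - m\<bar> - t / 2)))"
proof -
  \<comment> \<open>a point between \<open>m\<close> and \<open>x\<close> (if \<open>t \<le> \<bar>x - m\<bar>\<close>): then \<open>(x - z) * (z - m) \<ge> 0\<close>\<close>
  define z where "z = (if m \<le> x then m + t / 2 else m - t / 2)"
  \<comment> \<open>the width that costs only a constant factor in the exponent\<close>
  define \<delta> where "\<delta> = 1 / sqrt (real n)"
  have \<delta>: "0 < \<delta>" "\<delta>\<^sup>2 = 1 / real n"
    using n by (auto simp: \<delta>_def power_divide)
  have z: "\<bar>z\<bar> + \<delta> \<le> R"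
    using t unfolding z_def \<delta>_def by (auto simp: abs_if split: if_splits)
  have "ennreal (w * g0 * \<delta> * exp (- 1 / 2) * coord_lik n z y) \<le> evidence n (spike_slab w g) y" for y
    using slab_le_evidence[of w g g0 R \<delta> z n y] w g \<open>0 < g0\<close> g0 z \<delta> n by simp
  then have "expected_post n (spike_slab w g) m x
      \<le> ennreal (exp (- real n * (x - z) * (z - m)) / (w * g0 * \<delta> * exp (- 1 / 2)))"
    using n w \<open>0 < g0\<close> \<delta> by (intro expected_post_le) auto
  also have "exp (- real n * (x - z) * (z - m)) / (w * g0 * \<delta> * exp (- 1 / 2))
      = exp (1 / 2) * sqrt (real n) / (w * g0) * exp (- real n * (t / 2) * (\<bar>x - m\<bar> - t / 2))"
  proof -
    have "- real n * (x - z) * (z - m) = - real n * (t / 2) * (\<bar>x - m\<bar> - t / 2)"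
    proof (cases "m \<le> x")
      case True
      then show ?thesis by (simp add: z_def)
    next
      case False
      then have "(x - z) * (z - m) = t / 2 * (\<bar>x - m\<bar> - t / 2)"
        by (simp add: z_def algebra_simps)
      then show ?thesis by (simp only: mult.assoc)
    qed
    moreover have "v / (w * g0 * \<delta> * exp (- 1 / 2)) = exp (1 / 2) * sqrt (real n) / (w * g0) * v" for v
      by (simp add: \<delta>_def exp_minus field_simps)
    ultimately show ?thesis
      by (simp only:)
  qed
  finally show ?thesis .
qed

lemma max_mult_exp_le:
  fixes t u :: real
  assumes "0 < t" "0 < a"
  shows "max 0 (u - t) * exp (- a * (t / 2) * (u - t / 2)) \<le> exp (- a * t\<^sup>2 / 4) * (2 / (a * t))"
proof (cases "t \<le> u")
  case True
  define c where "c = a * t / 2"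
  have c: "0 < c" using assms by (simp add: c_def)
  have "v * exp (- (c * v)) \<le> 1 / c" for v
  proof -
    have "c * v \<le> exp (c * v)"
      using exp_ge_add_one_self[of "c * v"] by linarith
    then show ?thesis
      using c by (simp add: exp_minus field_simps)
  qed
  then have le: "(u - t) * exp (- (c * (u - t))) \<le> 1 / c" .
  moreover have "- a * (t / 2) * (u - t / 2) = - a * t\<^sup>2 / 4 + - (c * (u - t))"
    by (simp add: c_def power2_eq_square field_simps)
  ultimately have "max 0 (u - t) * exp (- a * (t / 2) * (u - t / 2))
      = exp (- a * t\<^sup>2 / 4) * ((u - t) * exp (- (c * (u - t))))"
    using True by (simp only: exp_add) simp
  also have "\<dots> \<le> exp (- a * t\<^sup>2 / 4) * (1 / c)"
    by (intro mult_left_mono le) simp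
  finally show ?thesis
    by (simp add: c_def)
qed (use assms in auto)

text \<open>The spike contributes only when \<open>t < \<bar>m\<bar>\<close>, at the price of the factor \<open>1 / w\<close>: it is the chance
  that a visible signal is missed. On the slab the weight \<open>w\<close> cancels, and the excess over \<open>t\<close> is
  absorbed by the exponential.\<close>

lemma nn_integral_excess_signal:
  assumes n: "1 \<le> n" and w: "0 < w" "w \<le> 1" and g[measurable]: "g \<in> borel_measurable borel"
    and g1: "(\<integral>\<^sup>+x. ennreal (g x) \<partial>lborel) = 1" and "0 < g0"
    and g0: "\<And>x. \<bar>x\<bar> \<le> R \<Longrightarrow> g0 \<le> g x"
    and t: "0 < t" "\<bar>m\<bar> + t / 2 + 1 / sqrt (real n) \<le> R"
  shows "(\<integral>\<^sup>+x. ennreal (max 0 (\<bar>x - m\<bar> - t)) * expected_post n (spike_slab w g) m x \<partial>spike_slab w g)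
    \<le> ennreal (exp (1 / 2) * sqrt (real n) / g0 * exp (- real n * t\<^sup>2 / 4) * (\<bar>m\<bar> / w + 2 / (real n * t)))"
proof -
  define G where "G = exp (1 / 2) * sqrt (real n) / g0 * exp (- real n * t\<^sup>2 / 4)"
  have G: "0 \<le> G" using \<open>0 < g0\<close> by (simp add: G_def)
  define h where "h x = ennreal (max 0 (\<bar>x - m\<bar> - t)) * expected_post n (spike_slab w g) m x" for x
  note signal = expected_post_spike_slab_signal[OF n w g g1 \<open>0 < g0\<close> g0 less_imp_le[OF t(1)] t(2)]
  have meas[measurable]: "expected_post n (spike_slab w g) m \<in> borel_measurable borel"
    using n w g g1
    by (intro measurable_expected_post prob_space_spike_slab sets_spike_slab) auto
  have [measurable]: "h \<in> borel_measurable borel"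
    unfolding h_def by measurable
  have h: "h x \<le> ennreal (G / w * (2 / (real n * t)))" for x
  proof -
    have "h x \<le> ennreal (max 0 (\<bar>x - m\<bar> - t)) *
        ennreal (exp (1 / 2) * sqrt (real n) / (w * g0) * exp (- real n * (t / 2) * (\<bar>x - m\<bar> - t / 2)))"
      unfolding h_def by (intro mult_left_mono signal) auto
    also have "\<dots> = ennreal (exp (1 / 2) * sqrt (real n) / (w * g0) *
        (max 0 (\<bar>x - m\<bar> - t) * exp (- real n * (t / 2) * (\<bar>x - m\<bar> - t / 2))))"
      by (subst ennreal_mult'[symmetric]) (simp_all add: ac_simps)
    also have "\<dots> \<le> ennreal (exp (1 / 2) * sqrt (real n) / (w * g0) *
        (exp (- real n * t\<^sup>2 / 4) * (2 / (real n * t))))"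
      using n w \<open>0 < g0\<close> t by (intro ennreal_leI mult_left_mono max_mult_exp_le) auto
    finally show ?thesis
      by (simp add: G_def mult.commute mult.left_commute)
  qed
  have h0: "h 0 \<le> ennreal (G / w * \<bar>m\<bar>)"
  proof (cases "t \<le> \<bar>m\<bar>")
    case True
    have "t * t \<le> t * \<bar>m\<bar>"
      using True t by (intro mult_left_mono) auto
    then have "real n * (t * t) \<le> real n * (t * \<bar>m\<bar>)"
      by (rule mult_left_mono) simp
    then have *: "- real n * (t / 2) * (\<bar>0 - m\<bar> - t / 2) \<le> - real n * t\<^sup>2 / 4"
      by (simp add: power2_eq_square algebra_simps)
    have "h 0 \<le> ennreal \<bar>m\<bar> *
        ennreal (exp (1 / 2) * sqrt (real n) / (w * g0) * exp (- real n * (t / 2) * (\<bar>0 - m\<bar> - t / 2)))"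
      unfolding h_def using t by (intro mult_mono signal ennreal_leI) auto
    also have "\<dots> \<le> ennreal \<bar>m\<bar> *
        ennreal (exp (1 / 2) * sqrt (real n) / (w * g0) * exp (- real n * t\<^sup>2 / 4))"
      using w \<open>0 < g0\<close> * by (intro mult_left_mono ennreal_leI) auto
    also have "\<dots> = ennreal (G / w * \<bar>m\<bar>)"
      by (simp add: ennreal_mult'[symmetric] G_def ac_simps)
    finally show ?thesis .
  next
    case False
    then show ?thesis by (simp add: h_def)
  qed
  have "(\<integral>\<^sup>+x. h x \<partial>spike_slab w g)
      = ennreal (1 - w) * h 0 + ennreal w * (\<integral>\<^sup>+x. ennreal (g x) * h x \<partial>lborel)"
    using w g1 by (intro nn_integral_spike_slab) auto
  also have "\<dots> \<le> 1 * ennreal (G / w * \<bar>m\<bar>)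
      + ennreal w * (\<integral>\<^sup>+x. ennreal (g x) * ennreal (G / w * (2 / (real n * t))) \<partial>lborel)"
    using w h by (intro add_mono mult_mono h0 nn_integral_mono) auto
  also have "\<dots> = ennreal (G / w * \<bar>m\<bar>) + ennreal w * ennreal (G / w * (2 / (real n * t)))"
    by (simp add: nn_integral_multc g1)
  also have "\<dots> = ennreal (G / w * \<bar>m\<bar>) + ennreal (G * (2 / (real n * t)))"
    using w by (simp add: ennreal_mult'[symmetric])
  also have "\<dots> = ennreal (G * (\<bar>m\<bar> / w + 2 / (real n * t)))"
    unfolding distrib_left using G w n t by (subst ennreal_plus) auto
  finally show ?thesis
    unfolding h_def[abs_def] G_def .
qed

text \<open>For a small signal even the threshold \<open>a \<ge> \<bar>m\<bar>\<close> is exceeded only with small probability: at the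
  spike there is no excess, and within distance \<open>2 t\<close> the slab gives a term proportional to \<open>w\<close>.
  Farther out, the excess over \<open>a\<close> is at most twice the excess over \<open>t\<close>.\<close>

lemma nn_integral_excess_null:
  assumes n: "1 \<le> n" and w: "0 < w" "w < 1" and g[measurable]: "g \<in> borel_measurable borel"
    and g1: "(\<integral>\<^sup>+x. ennreal (g x) \<partial>lborel) = 1" and "0 < g0"
    and g0: "\<And>x. \<bar>x\<bar> \<le> R \<Longrightarrow> g0 \<le> g x"
    and t: "0 < t" "\<bar>m\<bar> + t / 2 + 1 / sqrt (real n) \<le> R" and m: "\<bar>m\<bar> \<le> a"
  shows "(\<integral>\<^sup>+x. ennreal (max 0 (\<bar>x - m\<bar> - a)) * expected_post n (spike_slab w g) m x \<partial>spike_slab w g)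
    \<le> ennreal (w * (2 * t) * (exp (real n * (a * (2 * t + a))) / (1 - w)) +
        2 * (exp (1 / 2) * sqrt (real n) / g0 * exp (- real n * t\<^sup>2 / 4) * (\<bar>m\<bar> / w + 2 / (real n * t))))"
proof -
  let ?\<phi> = "expected_post n (spike_slab w g) m"
  define E where "E = exp (real n * (a * (2 * t + a))) / (1 - w)"
  have E: "0 \<le> E" using w by (simp add: E_def)
  have a: "0 \<le> a" using m by simp
  have [measurable]: "?\<phi> \<in> borel_measurable borel"
    using n w g g1
    by (intro measurable_expected_post prob_space_spike_slab sets_spike_slab) auto
  define h where "h x = ennreal (2 * t) * indicator {x. a < \<bar>x - m\<bar> \<and> \<bar>x - m\<bar> \<le> 2 * t} x * ?\<phi> x" for x
  have [measurable]: "h \<in> borel_measurable borel"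
    unfolding h_def by measurable
  have h: "h x \<le> ennreal (2 * t * E)" for x
  proof (cases "\<bar>x - m\<bar> \<le> 2 * t")
    case True
    have "x * m \<le> \<bar>x\<bar> * \<bar>m\<bar>"
      by (simp add: abs_mult[symmetric])
    also have "\<dots> \<le> (2 * t + a) * a"
      using m True by (intro mult_mono) auto
    finally have "real n * (x * m) \<le> real n * (a * (2 * t + a))"
      by (intro mult_left_mono) (auto simp: mult.commute)
    then have "exp (real n * x * m) / (1 - w) \<le> E"
      using w unfolding E_def by (intro divide_right_mono) (auto simp: mult.assoc)
    then have "?\<phi> x \<le> ennreal E"
      using expected_post_spike_slab_null[OF n less_imp_le[OF w(1)] w(2) g g1, of m x]
      by (meson ennreal_leI order_trans)
    then have "h x \<le> ennreal (2 * t) * 1 * ennreal E"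
      unfolding h_def by (intro mult_mono) (auto simp: indicator_def)
    then show ?thesis
      using t E by (simp add: ennreal_mult'[symmetric])
  qed (simp add: h_def)
  have h0: "h 0 = 0"
    using m by (simp add: h_def)
  have hint: "(\<integral>\<^sup>+x. h x \<partial>spike_slab w g) \<le> ennreal (w * (2 * t) * E)"
  proof -
    have "(\<integral>\<^sup>+x. h x \<partial>spike_slab w g) = ennreal w * (\<integral>\<^sup>+x. ennreal (g x) * h x \<partial>lborel)"
      using w g1 h0 by (subst nn_integral_spike_slab) auto
    also have "\<dots> \<le> ennreal w * (\<integral>\<^sup>+x. ennreal (g x) * ennreal (2 * t * E) \<partial>lborel)"
      using h by (intro mult_left_mono nn_integral_mono) auto
    also have "\<dots> = ennreal (w * (2 * t) * E)"
      using w t E by (simp add: nn_integral_multc g1 ennreal_mult'[symmetric] mult.assoc)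
    finally show ?thesis .
  qed
  have "(\<integral>\<^sup>+x. ennreal (max 0 (\<bar>x - m\<bar> - a)) * ?\<phi> x \<partial>spike_slab w g)
      \<le> (\<integral>\<^sup>+x. h x + 2 * (ennreal (max 0 (\<bar>x - m\<bar> - t)) * ?\<phi> x) \<partial>spike_slab w g)"
  proof (intro nn_integral_mono)
    fix x
    let ?S = "{x. a < \<bar>x - m\<bar> \<and> \<bar>x - m\<bar> \<le> 2 * t}"
    have "max 0 (\<bar>x - m\<bar> - a) \<le> 2 * t * indicator ?S x + 2 * max 0 (\<bar>x - m\<bar> - t)"
      using a t by (cases "x \<in> ?S") (auto simp: max_def)
    then have "ennreal (max 0 (\<bar>x - m\<bar> - a)) \<le> ennreal (2 * t * indicator ?S x + 2 * max 0 (\<bar>x - m\<bar> - t))"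
      by (rule ennreal_leI)
    also have "\<dots> = ennreal (2 * t * indicator ?S x) + ennreal (2 * max 0 (\<bar>x - m\<bar> - t))"
      using t by (intro ennreal_plus) auto
    also have "\<dots> = ennreal (2 * t) * indicator ?S x + 2 * ennreal (max 0 (\<bar>x - m\<bar> - t))"
      using t by (cases "x \<in> ?S") (simp_all add: ennreal_mult')
    finally have "ennreal (max 0 (\<bar>x - m\<bar> - a))
        \<le> ennreal (2 * t) * indicator ?S x + 2 * ennreal (max 0 (\<bar>x - m\<bar> - t))" .
    then have "ennreal (max 0 (\<bar>x - m\<bar> - a)) * ?\<phi> x
        \<le> (ennreal (2 * t) * indicator {x. a < \<bar>x - m\<bar> \<and> \<bar>x - m\<bar> \<le> 2 * t} x
          + 2 * ennreal (max 0 (\<bar>x - m\<bar> - t))) * ?\<phi> x"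
      by (rule mult_right_mono) simp
    then show "ennreal (max 0 (\<bar>x - m\<bar> - a)) * ?\<phi> x
        \<le> h x + 2 * (ennreal (max 0 (\<bar>x - m\<bar> - t)) * ?\<phi> x)"
      by (simp add: h_def distrib_right mult.assoc)
  qed
  also have "\<dots> = (\<integral>\<^sup>+x. h x \<partial>spike_slab w g)
      + 2 * (\<integral>\<^sup>+x. ennreal (max 0 (\<bar>x - m\<bar> - t)) * ?\<phi> x \<partial>spike_slab w g)"
    by (subst nn_integral_add, simp_all add: sets_spike_slab[OF g g1] cong: measurable_cong_sets)
       (subst nn_integral_cmult, simp_all add: sets_spike_slab[OF g g1] cong: measurable_cong_sets)
  also have "\<dots> \<le> ennreal (w * (2 * t) * E) + 2 * ennreal (exp (1 / 2) * sqrt (real n) / g0 *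
      exp (- real n * t\<^sup>2 / 4) * (\<bar>m\<bar> / w + 2 / (real n * t)))"
    using w by (intro add_mono hint mult_left_mono nn_integral_excess_signal[where R = R] assms) auto
  also have "\<dots> = ennreal (w * (2 * t) * E + 2 * (exp (1 / 2) * sqrt (real n) / g0 *
      exp (- real n * t\<^sup>2 / 4) * (\<bar>m\<bar> / w + 2 / (real n * t))))"
    using w t E n \<open>0 < g0\<close>
    by (subst ennreal_plus) (auto simp: ennreal_mult'[symmetric] ennreal_numeral[symmetric] simp del: ennreal_numeral)
  finally show ?thesis
    unfolding E_def .
qed

section \<open>The posterior of a product prior\<close>

text \<open>A product prior under which all coordinates above level \<open>J\<close> vanish. Only the finitely many levels up
  to \<open>J\<close> then enter the likelihood.\<close>

locale level_prior =
  fixes I :: "nat \<Rightarrow> 'k set" and \<mu> :: "nat \<times> 'k \<Rightarrow> real measure" and J :: nat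
  assumes fin: "\<And>j. finite (I j)"
    and prob: "\<And>i. prob_space (\<mu> i)"
    and sets_mu [measurable_cong]: "\<And>i. sets (\<mu> i) = sets borel"
    and null: "\<And>j k. J < j \<Longrightarrow> \<mu> (j, k) = return borel 0"
begin

lemma countable_Lam: "countable (Lam I)"
  unfolding Lam_def by (rule countable_SIGMA) (simp_all add: countable_finite fin)

lemma sets_prior: "sets (PiM (Lam I) \<mu>) = sets (seq_space I)"
  by (intro sets_PiM_cong) (auto simp: sets_mu)

lemma measurable_coordinate [measurable]:
  "i \<in> Lam I \<Longrightarrow> (\<lambda>\<theta>. \<theta> i) \<in> borel_measurable (PiM (Lam I) \<mu>)"
  by (subst measurable_cong_sets[OF sets_prior refl]) (rule measurable_component_singleton)

lemma measurable_coordinate_at [measurable]: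
  "k \<in> I j \<Longrightarrow> (\<lambda>\<theta>. \<theta> (j, k)) \<in> borel_measurable (PiM (Lam I) \<mu>)"
  by (rule measurable_coordinate) (simp add: Lam_def)

lemma measurable_likelihood [measurable]:
  "(\<lambda>\<theta>. likelihood I n \<theta> y) \<in> borel_measurable (PiM (Lam I) \<mu>)"
  unfolding likelihood_def by measurable

lemma AE_null_above: "AE \<theta> in PiM (Lam I) \<mu>. \<forall>j>J. \<forall>k\<in>I j. \<theta> (j, k) = 0"
proof -
  have "AE \<theta> in PiM (Lam I) \<mu>. \<theta> i = 0" if "i \<in> Lam I" "J < fst i" for i
  proof (rule AE_PiM_component[OF prob \<open>i \<in> Lam I\<close>])
    show "AE x in \<mu> i. x = 0"
    proof -
      have "\<mu> i = return borel 0"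
        using null[of "fst i" "snd i"] \<open>J < fst i\<close> by simp
      then show ?thesis
        by (simp only:) (subst AE_return, auto)
    qed
  qed
  then have "AE \<theta> in PiM (Lam I) \<mu>. \<forall>i\<in>{i \<in> Lam I. J < fst i}. \<theta> i = 0"
    by (subst AE_ball_countable) (auto intro: countable_subset[OF _ countable_Lam])
  then show ?thesis
    by eventually_elim (auto simp: Lam_def)
qed

lemma likelihood_eq_prod:
  assumes "\<forall>j>m. \<forall>k\<in>I j. \<theta> (j, k) = 0"
  shows "likelihood I n \<theta> y = (\<Prod>i\<in>Sigma {..m} I. coord_lik n (\<theta> i) (y i))"
proof -
  have "(\<Sum>j. \<Sum>k\<in>I j. y (j, k) * \<theta> (j, k)) = (\<Sum>j\<le>m. \<Sum>k\<in>I j. y (j, k) * \<theta> (j, k))"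
    using assms by (intro suminf_finite) (auto simp: not_le)
  moreover have "(\<Sum>j. \<Sum>k\<in>I j. (\<theta> (j, k))\<^sup>2) = (\<Sum>j\<le>m. \<Sum>k\<in>I j. (\<theta> (j, k))\<^sup>2)"
    using assms by (intro suminf_finite) (auto simp: not_le)
  ultimately have "likelihood I n \<theta> y
      = exp (\<Sum>j\<le>m. \<Sum>k\<in>I j. real n * (y (j, k) * \<theta> (j, k) - (\<theta> (j, k))\<^sup>2 / 2))"
    by (simp add: likelihood_def sum_distrib_left sum_subtractf[symmetric] right_diff_distrib)
  also have "\<dots> = exp (\<Sum>i\<in>Sigma {..m} I. real n * (y i * \<theta> i - (\<theta> i)\<^sup>2 / 2))"
    using fin by (subst sum.Sigma) (auto simp: split_def)
  also have "\<dots> = (\<Prod>i\<in>Sigma {..m} I. coord_lik n (\<theta> i) (y i))"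
    using fin unfolding coord_lik_def by (intro exp_sum finite_SigmaI) auto
  finally show ?thesis .
qed

lemma nn_integral_prior_prod:
  assumes F: "finite F" "F \<subseteq> Lam I" and f[measurable]: "\<And>i. f i \<in> borel_measurable borel"
  shows "(\<integral>\<^sup>+\<theta>. (\<Prod>i\<in>F. f i (\<theta> i)) \<partial>PiM (Lam I) \<mu>) = (\<Prod>i\<in>F. \<integral>\<^sup>+x. f i x \<partial>\<mu> i)"
proof -
  interpret prob_space "\<mu> i" for i by (rule prob)
  interpret product_prob_space \<mu> "Lam I" ..
  have "(\<lambda>x. f i (x i)) \<in> borel_measurable (PiM F \<mu>)" if "i \<in> F" for i
    using that by (intro measurable_compose[OF measurable_component_singleton])
      (simp_all add: measurable_cong_sets[OF sets_mu refl])
  then have [measurable]: "(\<lambda>x. \<Prod>i\<in>F. f i (x i)) \<in> borel_measurable (PiM F \<mu>)"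
    by (rule borel_measurable_prod_ennreal)
  have "(\<Prod>i\<in>F. \<integral>\<^sup>+x. f i x \<partial>\<mu> i) = (\<integral>\<^sup>+x. (\<Prod>i\<in>F. f i (x i)) \<partial>PiM F \<mu>)"
    using F by (subst product_nn_integral_prod) (simp_all add: measurable_cong_sets[OF sets_mu refl])
  also have "\<dots> = (\<integral>\<^sup>+x. (\<Prod>i\<in>F. f i (x i)) \<partial>distr (PiM (Lam I) \<mu>) (PiM F \<mu>) (\<lambda>x. restrict x F))"
    using F by (subst distr_PiM_restrict_finite) auto
  also have "\<dots> = (\<integral>\<^sup>+\<theta>. (\<Prod>i\<in>F. f i (\<theta> i)) \<partial>PiM (Lam I) \<mu>)"
    using F by (subst nn_integral_distr) (auto intro!: measurable_restrict_subset nn_integral_cong prod.cong)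
  finally show ?thesis by simp
qed

text \<open>The level \<open>m\<close> may exceed \<open>J\<close>, so that coordinates above the level \<open>J\<close>, where the prior is a point
  mass, are covered by the same formula.\<close>

lemma nn_integral_coordinate_likelihood:
  assumes i: "i \<in> Lam I" and f[measurable]: "f \<in> borel_measurable borel" and "J \<le> m" "fst i \<le> m"
  shows "(\<integral>\<^sup>+\<theta>. f (\<theta> i) * ennreal (likelihood I n \<theta> y) \<partial>PiM (Lam I) \<mu>)
    = (\<integral>\<^sup>+x. f x * ennreal (coord_lik n x (y i)) \<partial>\<mu> i) *
      (\<Prod>l\<in>Sigma {..m} I - {i}. evidence n (\<mu> l) (y l))"
proof -
  let ?F = "Sigma {..m} I"
  have F: "finite ?F" "?F \<subseteq> Lam I" "i \<in> ?F"
    using fin assms by (auto simp: Lam_def)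
  \<comment> \<open>the integrand as a product over coordinates, with \<open>f\<close> attached to the factor \<open>i\<close>\<close>
  define h where "h l x = (if l = i then f x else 1) * ennreal (coord_lik n x (y l))" for l x
  have [measurable]: "h l \<in> borel_measurable borel" for l
    unfolding h_def by measurable
  have "(\<integral>\<^sup>+\<theta>. f (\<theta> i) * ennreal (likelihood I n \<theta> y) \<partial>PiM (Lam I) \<mu>)
      = (\<integral>\<^sup>+\<theta>. (\<Prod>l\<in>?F. h l (\<theta> l)) \<partial>PiM (Lam I) \<mu>)"
  proof (rule nn_integral_cong_AE, use AE_null_above in eventually_elim)
    fix \<theta> :: "nat \<times> 'k \<Rightarrow> real"
    assume "\<forall>j>J. \<forall>k\<in>I j. \<theta> (j, k) = 0"
    then have "likelihood I n \<theta> y = (\<Prod>l\<in>?F. coord_lik n (\<theta> l) (y l))"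
      using \<open>J \<le> m\<close> by (intro likelihood_eq_prod) auto
    then have "ennreal (likelihood I n \<theta> y) = (\<Prod>l\<in>?F. ennreal (coord_lik n (\<theta> l) (y l)))"
      using coord_lik_pos[of n] by (simp add: prod_ennreal less_imp_le)
    then show "f (\<theta> i) * ennreal (likelihood I n \<theta> y) = (\<Prod>l\<in>?F. h l (\<theta> l))"
      using F by (simp add: h_def prod.distrib prod.delta)
  qed
  also have "\<dots> = (\<Prod>l\<in>?F. \<integral>\<^sup>+x. h l x \<partial>\<mu> l)"
    using F by (intro nn_integral_prior_prod) auto
  also have "\<dots> = (\<integral>\<^sup>+x. h i x \<partial>\<mu> i) * (\<Prod>l\<in>?F - {i}. \<integral>\<^sup>+x. h l x \<partial>\<mu> l)"
    using F by (intro prod.remove)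
  also have "\<dots> = (\<integral>\<^sup>+x. f x * ennreal (coord_lik n x (y i)) \<partial>\<mu> i) *
      (\<Prod>l\<in>?F - {i}. evidence n (\<mu> l) (y l))"
    by (intro arg_cong2[where f = "(*)"] prod.cong) (auto simp: h_def evidence_def)
  finally show ?thesis .
qed

lemma nn_integral_posterior_coordinate:
  assumes i: "i \<in> Lam I" and f[measurable]: "f \<in> borel_measurable borel"
  shows "(\<integral>\<^sup>+\<theta>. f (\<theta> i) \<partial>posterior I (PiM (Lam I) \<mu>) n y) = coord_post n (\<mu> i) f (y i)"
proof -
  define m where "m = max J (fst i)"
  define R where "R = (\<Prod>l\<in>Sigma {..m} I - {i}. evidence n (\<mu> l) (y l))"
  have m: "J \<le> m" "fst i \<le> m" by (auto simp: m_def)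
  have R: "R \<noteq> 0" "R \<noteq> \<infinity>"
  proof -
    have "evidence n (\<mu> l) (y l) \<noteq> 0" "evidence n (\<mu> l) (y l) \<noteq> top" for l
      using evidence_pos[OF prob sets_mu, of n l "y l"] evidence_finite[OF prob, of n l "y l"] by auto
    then show "R \<noteq> 0" "R \<noteq> \<infinity>"
      by (simp_all add: R_def fin ennreal_prod_eq_top)
  qed
  note * = nn_integral_coordinate_likelihood[OF i _ m, of _ n y, folded R_def]
  have "(\<integral>\<^sup>+\<theta>. ennreal (likelihood I n \<theta> y) \<partial>PiM (Lam I) \<mu>) = evidence n (\<mu> i) (y i) * R"
    using *[of "\<lambda>_. 1"] by (simp add: evidence_def)
  moreover have "(\<integral>\<^sup>+\<theta>. f (\<theta> i) \<partial>posterior I (PiM (Lam I) \<mu>) n y)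
    = (\<integral>\<^sup>+\<theta>. f (\<theta> i) * ennreal (likelihood I n \<theta> y) /
        (\<integral>\<^sup>+\<theta>'. ennreal (likelihood I n \<theta>' y) \<partial>PiM (Lam I) \<mu>) \<partial>PiM (Lam I) \<mu>)"
    unfolding posterior_def using i
    by (subst nn_integral_density) (simp_all add: ennreal_times_divide ennreal_divide_times mult.commute)
  ultimately show ?thesis
    using R i by (simp add: nn_integral_divide * coord_post_def divide_mult_eq)
qed

lemma nn_integral_posterior_const:
  assumes "i \<in> Lam I"
  shows "(\<integral>\<^sup>+\<theta>. c \<partial>posterior I (PiM (Lam I) \<mu>) n y) = c"
proof -
  have "evidence n (\<mu> i) (y i) \<noteq> 0" "evidence n (\<mu> i) (y i) < top"
    using evidence_pos[OF prob sets_mu, of n i "y i"] evidence_finite[OF prob, of n i "y i"] by auto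
  then have "coord_post n (\<mu> i) (\<lambda>_. 1) (y i) = 1"
    by (simp add: coord_post_def evidence_def[symmetric])
  then have "emeasure (posterior I (PiM (Lam I) \<mu>) n y) (space (posterior I (PiM (Lam I) \<mu>) n y)) = 1"
    using nn_integral_posterior_coordinate[OF assms, of "\<lambda>_. 1" n y] by simp
  then show ?thesis by simp
qed

end

section \<open>Loss of the Bayes estimator\<close>

lemma suminf_add_ennreal: "(\<Sum>j. f j + g j :: ennreal) = (\<Sum>j. f j) + (\<Sum>j. g j)"
  by (rule suminf_add[symmetric]) auto

lemma loss_triangle:
  assumes "\<And>j. finite (I j)" "\<And>j. I j \<noteq> {}"
  shows "loss I a c \<le> loss I a b + loss I c b"
  unfolding loss_def suminf_add_ennreal[symmetric]
proof (intro suminf_le allI)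
  fix j
  let ?d = "\<lambda>a b. Max ((\<lambda>k. \<bar>a (j, k) - b (j, k)\<bar>) ` I j)"
  have d: "0 \<le> ?d a b" for a b :: "nat \<times> 'a \<Rightarrow> real"
    using assms by (auto simp: Max_ge_iff intro!: )
  have "?d a c \<le> ?d a b + ?d c b"
  proof (subst Max_le_iff)
    show "\<forall>u\<in>(\<lambda>k. \<bar>a (j, k) - c (j, k)\<bar>) ` I j. u \<le> ?d a b + ?d c b"
    proof safe
      fix k assume "k \<in> I j"
      then have "\<bar>a (j, k) - b (j, k)\<bar> \<le> ?d a b" "\<bar>c (j, k) - b (j, k)\<bar> \<le> ?d c b"
        using assms by (auto intro!: Max_ge)
      then show "\<bar>a (j, k) - c (j, k)\<bar> \<le> ?d a b + ?d c b" by linarith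
    qed
  qed (use assms in auto)
  then have "2 powr (real j / 2) * ?d a c \<le> 2 powr (real j / 2) * (?d a b + ?d c b)"
    by (rule mult_left_mono) simp
  then show "ennreal (2 powr (real j / 2) * ?d a c)
      \<le> ennreal (2 powr (real j / 2) * ?d a b) + ennreal (2 powr (real j / 2) * ?d c b)"
    using d by (simp add: ennreal_plus[symmetric] distrib_left ennreal_leI del: ennreal_plus)
qed auto

text \<open>Bounding a maximum over \<open>k\<close> by a threshold plus the sum of the excesses reduces the loss to
  functionals of single coordinates. Nothing is lost in the rate if the excesses are negligible even
  after summation.\<close>

lemma loss_le_excess:
  assumes "\<And>j. finite (I j)" "\<And>j. I j \<noteq> {}" "\<And>j. 0 \<le> t j"
  shows "loss I a b \<le> (\<Sum>j. ennreal (2 powr (real j / 2) * t j)) +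
    (\<Sum>j. ennreal (2 powr (real j / 2)) * (\<Sum>k\<in>I j. ennreal (max 0 (\<bar>b (j, k) - a (j, k)\<bar> - t j))))"
  unfolding loss_def suminf_add_ennreal[symmetric]
proof (intro suminf_le allI)
  fix j
  have "Max ((\<lambda>k. \<bar>a (j, k) - b (j, k)\<bar>) ` I j) \<le> t j + (\<Sum>k\<in>I j. max 0 (\<bar>b (j, k) - a (j, k)\<bar> - t j))"
  proof (subst Max_le_iff)
    show "\<forall>u\<in>(\<lambda>k. \<bar>a (j, k) - b (j, k)\<bar>) ` I j. u \<le> t j + (\<Sum>k\<in>I j. max 0 (\<bar>b (j, k) - a (j, k)\<bar> - t j))"
    proof safe
      fix k assume "k \<in> I j"
      then have "max 0 (\<bar>b (j, k) - a (j, k)\<bar> - t j) \<le> (\<Sum>k\<in>I j. max 0 (\<bar>b (j, k) - a (j, k)\<bar> - t j))"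
        using assms by (intro member_le_sum) auto
      then show "\<bar>a (j, k) - b (j, k)\<bar> \<le> t j + (\<Sum>k\<in>I j. max 0 (\<bar>b (j, k) - a (j, k)\<bar> - t j))"
        by linarith
    qed
  qed (use assms in auto)
  then have "ennreal (2 powr (real j / 2) * Max ((\<lambda>k. \<bar>a (j, k) - b (j, k)\<bar>) ` I j))
      \<le> ennreal (2 powr (real j / 2) * (t j + (\<Sum>k\<in>I j. max 0 (\<bar>b (j, k) - a (j, k)\<bar> - t j))))"
    by (intro ennreal_leI mult_left_mono) auto
  also have "\<dots> = ennreal (2 powr (real j / 2) * t j) +
      ennreal (2 powr (real j / 2)) * (\<Sum>k\<in>I j. ennreal (max 0 (\<bar>b (j, k) - a (j, k)\<bar> - t j)))"
    using assms(3) by (subst sum_ennreal) (simp_all add: distrib_left ennreal_plus sum_nonneg ennreal_mult'[symmetric])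
  finally show "ennreal (2 powr (real j / 2) * Max ((\<lambda>k. \<bar>a (j, k) - b (j, k)\<bar>) ` I j)) \<le> \<dots>" .
qed auto

lemma (in level_prior) measurable_loss [measurable]:
  "(\<lambda>\<theta>. loss I a \<theta>) \<in> borel_measurable (PiM (Lam I) \<mu>)"
proof -
  have [measurable]: "(\<lambda>\<theta>. Max ((\<lambda>k. \<bar>a (j, k) - \<theta> (j, k)\<bar>) ` I j)) \<in> borel_measurable (PiM (Lam I) \<mu>)" for j
    using fin by (intro borel_measurable_Max) auto
  show ?thesis
    unfolding loss_def by measurable
qed

lemma (in level_prior) posterior_risk_le:
  assumes ne: "\<And>j. I j \<noteq> {}" and t: "\<And>j. 0 \<le> t j"
  shows "posterior_risk I (PiM (Lam I) \<mu>) n y a \<le> (\<Sum>j. ennreal (2 powr (real j / 2) * t j)) +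
    (\<Sum>j. ennreal (2 powr (real j / 2)) *
      (\<Sum>k\<in>I j. coord_post n (\<mu> (j, k)) (\<lambda>x. ennreal (max 0 (\<bar>x - a (j, k)\<bar> - t j))) (y (j, k))))"
proof -
  let ?\<Pi> = "posterior I (PiM (Lam I) \<mu>) n y"
  have sets: "sets ?\<Pi> = sets (PiM (Lam I) \<mu>)"
    by (simp add: posterior_def)
  obtain k0 where "k0 \<in> I 0" using ne by blast
  then have i0: "(0, k0) \<in> Lam I" by (simp add: Lam_def)
  have [measurable]: "k \<in> I j \<Longrightarrow> (\<lambda>\<theta>. \<theta> (j, k)) \<in> borel_measurable ?\<Pi>" for j k
    unfolding measurable_cong_sets[OF sets refl] by (rule measurable_coordinate_at)
  have "posterior_risk I (PiM (Lam I) \<mu>) n y a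
    \<le> (\<integral>\<^sup>+\<theta>. (\<Sum>j. ennreal (2 powr (real j / 2) * t j)) +
    (\<Sum>j. ennreal (2 powr (real j / 2)) * (\<Sum>k\<in>I j. ennreal (max 0 (\<bar>\<theta> (j, k) - a (j, k)\<bar> - t j)))) \<partial>?\<Pi>)"
    unfolding posterior_risk_def using fin ne t by (intro nn_integral_mono loss_le_excess)
  also have "\<dots> = (\<Sum>j. ennreal (2 powr (real j / 2) * t j)) +
    (\<Sum>j. ennreal (2 powr (real j / 2)) * (\<Sum>k\<in>I j. \<integral>\<^sup>+\<theta>. ennreal (max 0 (\<bar>\<theta> (j, k) - a (j, k)\<bar> - t j)) \<partial>?\<Pi>))"
    by (simp add: nn_integral_add nn_integral_posterior_const[OF i0] nn_integral_suminf nn_integral_cmult nn_integral_sum del: nn_integral_const)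
  also have "\<dots> = (\<Sum>j. ennreal (2 powr (real j / 2) * t j)) +
    (\<Sum>j. ennreal (2 powr (real j / 2)) *
      (\<Sum>k\<in>I j. coord_post n (\<mu> (j, k)) (\<lambda>x. ennreal (max 0 (\<bar>x - a (j, k)\<bar> - t j))) (y (j, k))))"
    by (intro arg_cong2[where f = "(+)"] refl suminf_cong arg_cong2[where f = "(*)"] sum.cong
        nn_integral_posterior_coordinate[of "(j, k)" "\<lambda>x. ennreal (max 0 (\<bar>x - a (j, k)\<bar> - t j))" for j k])
       (auto simp: Lam_def)
  finally show ?thesis .
qed

text \<open>The true parameter competes in the minimization that defines the Bayes estimator. Hence, by the
  triangle inequality, an estimator minimizing the posterior risk is no farther from the truth than
  twice the posterior mean distance to it.\<close>

lemma (in level_prior) loss_bayes_le: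
  assumes ne: "\<And>j. I j \<noteq> {}" and "is_arg_min (posterior_risk I (PiM (Lam I) \<mu>) n y) (\<lambda>\<delta>. \<delta> \<in> ell2 I) b"
    and "a \<in> ell2 I"
  shows "loss I b a \<le> 2 * posterior_risk I (PiM (Lam I) \<mu>) n y a"
proof -
  let ?\<Pi> = "posterior I (PiM (Lam I) \<mu>) n y"
  have sets: "sets ?\<Pi> = sets (PiM (Lam I) \<mu>)"
    by (simp add: posterior_def)
  obtain k0 where "k0 \<in> I 0" using ne by blast
  then have i0: "(0, k0) \<in> Lam I" by (simp add: Lam_def)
  have [measurable]: "(\<lambda>\<theta>. loss I a \<theta>) \<in> borel_measurable ?\<Pi>" for a
    unfolding measurable_cong_sets[OF sets refl] by (rule measurable_loss)
  have "loss I b a = (\<integral>\<^sup>+\<theta>. loss I b a \<partial>?\<Pi>)"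
    by (rule nn_integral_posterior_const[OF i0, symmetric])
  also have "\<dots> \<le> (\<integral>\<^sup>+\<theta>. loss I b \<theta> + loss I a \<theta> \<partial>?\<Pi>)"
    by (intro nn_integral_mono loss_triangle fin ne)
  also have "\<dots> = posterior_risk I (PiM (Lam I) \<mu>) n y b + posterior_risk I (PiM (Lam I) \<mu>) n y a"
    unfolding posterior_risk_def by (rule nn_integral_add) measurable
  also have "posterior_risk I (PiM (Lam I) \<mu>) n y b \<le> posterior_risk I (PiM (Lam I) \<mu>) n y a"
    using assms unfolding is_arg_min_def by (auto simp: not_less)
  finally show ?thesis
    by (simp add: mult_2 add_right_mono)
qed

section \<open>Balancing bias and noise\<close>

text \<open>For \<open>r\<close> the value of \<open>2\<^sup>j\<close> at which a bias decreasing in \<open>j\<close> meets a noise term increasing in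
  \<open>j\<close>, this is the level where a sum over \<open>j\<close> has to be split; the case \<open>N = 0\<close> leaves no levels below.\<close>

lemma dyadic_crossing:
  fixes r :: real
  obtains N :: nat where "r \<le> 2 ^ N" and "N = 0 \<or> 2 ^ N < 2 * r"
proof -
  obtain m where m: "r \<le> 2 ^ m"
    using real_arch_pow[of 2 r] by (auto intro: less_imp_le)
  define N where "N = (LEAST j. r \<le> 2 ^ j)"
  have "r \<le> 2 ^ N"
    unfolding N_def using m by (rule LeastI)
  moreover have "N = 0 \<or> 2 ^ N < 2 * r"
  proof (cases N)
    case (Suc k)
    then have "\<not> r \<le> 2 ^ k"
      unfolding N_def by (intro not_less_Least) simp
    then show ?thesis using Suc by simp
  qed simp
  ultimately show thesis by (rule that)
qed

text \<open>Both terms in the minimum are geometric in \<open>j\<close> and they cross where \<open>2\<^sup>j\<close> is about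
  \<open>s powr (- 2 / (2 * \<beta> + 1))\<close>, so the sum is of the order of the value at the crossing. There is no
  logarithmic loss.\<close>

lemma suminf_min_powr_le:
  fixes s \<beta> \<beta>1 :: real
  assumes s: "0 < s" and \<beta>: "0 < \<beta>1" "\<beta>1 \<le> \<beta>"
  shows "(\<Sum>j. ennreal (min (2 powr (- real j * \<beta>)) (2 powr (real j / 2) * s)))
    \<le> ennreal ((6 + 1 / (1 - 2 powr - \<beta>1)) * s powr (2 * \<beta> / (2 * \<beta> + 1)))"
proof -
  define r where "r = s powr (- 2 / (2 * \<beta> + 1))"
  define \<rho> where "\<rho> = s powr (2 * \<beta> / (2 * \<beta> + 1))"
  have r: "0 < r" using s by (simp add: r_def)
  \<comment> \<open>the two geometric terms agree at the crossing, with common value \<open>\<rho>\<close>\<close>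
  have low: "s * r powr (1 / 2) = \<rho>"
  proof -
    have "r powr (1 / 2) = s powr (- 1 / (2 * \<beta> + 1))"
    proof -
      have "- 2 / (2 * \<beta> + 1) * (1 / 2) = - 1 / (2 * \<beta> + 1)"
        using \<beta> by (simp add: field_simps)
      then show ?thesis by (simp only: r_def powr_powr)
    qed
    then have "s * r powr (1 / 2) = s powr (1 + - 1 / (2 * \<beta> + 1))"
      using s by (simp only: powr_add powr_one)
    also have "1 + - 1 / (2 * \<beta> + 1) = 2 * \<beta> / (2 * \<beta> + 1)"
      using \<beta> by (simp add: field_simps)
    finally show ?thesis by (simp add: \<rho>_def)
  qed
  have high: "r powr - \<beta> = \<rho>"
    by (simp add: r_def powr_powr \<rho>_def)
  obtain N where N: "r \<le> 2 ^ N" "N = 0 \<or> 2 ^ N < 2 * r"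
    by (rule dyadic_crossing)
  let ?f = "\<lambda>j. min (2 powr (- real j * \<beta>)) (2 powr (real j / 2) * s)"
  define q where "q = sqrt 2"
  have q: "1 < q" "q\<^sup>2 = 2" "1 \<le> 3 * (q - 1)"
    unfolding q_def using real_le_rsqrt[of "4 / 3" 2] by (auto simp: power2_eq_square)
  have pq: "2 powr (real j / 2) = q ^ j" for j
    by (simp add: q_def powr_half_sqrt[symmetric] powr_powr powr_realpow[symmetric])
  have head: "(\<Sum>j<N. ?f j) \<le> 6 * \<rho>"
  proof (cases "N = 0")
    case False
    then have "2 ^ N < 2 * r" using N by simp
    then have "sqrt (2 ^ N) \<le> sqrt (2 * r)" by simp
    then have qN: "q ^ N \<le> q * r powr (1 / 2)"
      using r by (simp add: q_def real_sqrt_power real_sqrt_mult powr_half_sqrt)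
    have "(\<Sum>j<N. ?f j) \<le> (\<Sum>j<N. s * q ^ j)"
      by (intro sum_mono) (simp add: pq mult.commute)
    also have "\<dots> = s * ((q ^ N - 1) / (q - 1))"
      using q by (simp add: sum_distrib_left[symmetric] geometric_sum)
    also have "\<dots> \<le> s * (q ^ N * 3)"
    proof (rule mult_left_mono)
      have "q ^ N * 1 \<le> q ^ N * (3 * (q - 1))"
        using q by (intro mult_left_mono) auto
      then have "q ^ N - 1 \<le> q ^ N * 3 * (q - 1)"
        unfolding mult.assoc mult_1_right by linarith
      moreover have "0 < q - 1" using q by simp
      ultimately show "(q ^ N - 1) / (q - 1) \<le> q ^ N * 3"
        by (simp only: pos_divide_le_eq)
    qed (use s in auto)
    also have "\<dots> \<le> s * (q * r powr (1 / 2) * 3)"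
      using qN s by (intro mult_left_mono mult_right_mono) auto
    also have "\<dots> = 3 * q * \<rho>"
      by (simp add: low[symmetric])
    also have "\<dots> \<le> 6 * \<rho>"
      unfolding q_def using sqrt2_less_2 by (intro mult_right_mono) (auto simp: \<rho>_def)
    finally show ?thesis .
  qed (simp add: \<rho>_def)
  define p where "p = 2 powr - \<beta>"
  have p: "0 < p" "p \<le> 2 powr - \<beta>1" "2 powr - \<beta>1 < 1"
    using \<beta> by (auto simp: p_def powr_minus inverse_eq_divide intro!: frac_le)
  have "(\<lambda>j. p ^ N * p ^ j) sums (p ^ N * (1 / (1 - p)))"
    using p by (intro sums_mult geometric_sums) auto
  then have geo: "(\<Sum>j. ennreal (p ^ N * p ^ j)) = ennreal (p ^ N * (1 / (1 - p)))"
    using p by (intro suminf_ennreal_eq) auto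
  have shift: "?f (j + N) \<le> p ^ N * p ^ j" for j
  proof -
    have "?f (j + N) \<le> 2 powr (- real (j + N) * \<beta>)" by simp
    also have "\<dots> = p ^ N * p ^ j"
      by (simp add: p_def powr_realpow[symmetric] powr_powr powr_add[symmetric] algebra_simps)
    finally show ?thesis .
  qed
  have "p ^ N * (1 / (1 - p)) \<le> 1 / (1 - 2 powr - \<beta>1) * \<rho>"
  proof -
    have "p ^ N = (2 ^ N) powr - \<beta>"
      by (simp add: p_def powr_realpow[symmetric] powr_powr mult.commute)
    also have "\<dots> \<le> r powr - \<beta>"
      using N r \<beta> by (intro powr_mono2') auto
    finally have "p ^ N \<le> \<rho>" by (simp add: high)
    then have "p ^ N * (1 / (1 - p)) \<le> \<rho> * (1 / (1 - 2 powr - \<beta>1))"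
      using p by (intro mult_mono frac_le) (auto simp: \<rho>_def)
    then show ?thesis by (simp add: mult.commute)
  qed
  then have "ennreal (p ^ N * (1 / (1 - p))) \<le> ennreal (1 / (1 - 2 powr - \<beta>1) * \<rho>)"
    by (rule ennreal_leI)
  moreover have "(\<Sum>j. ennreal (?f (j + N))) \<le> (\<Sum>j. ennreal (p ^ N * p ^ j))"
    by (intro suminf_le ennreal_leI shift) auto
  ultimately have tail: "(\<Sum>j. ennreal (?f (j + N))) \<le> ennreal (1 / (1 - 2 powr - \<beta>1) * \<rho>)"
    unfolding geo by (rule order_trans[rotated])
  have "(\<Sum>j<N. ennreal (?f j)) = ennreal (\<Sum>j<N. ?f j)"
    using s by (intro sum_ennreal) auto
  also have "\<dots> \<le> ennreal (6 * \<rho>)"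
    by (intro ennreal_leI head)
  finally have head': "(\<Sum>j<N. ennreal (?f j)) \<le> ennreal (6 * \<rho>)" .
  have "(\<Sum>j. ennreal (?f j)) = (\<Sum>j. ennreal (?f (j + N))) + (\<Sum>j<N. ennreal (?f j))"
    by (rule suminf_offset) auto
  also have "\<dots> \<le> ennreal (1 / (1 - 2 powr - \<beta>1) * \<rho>) + ennreal (6 * \<rho>)"
    by (rule add_mono[OF tail head'])
  also have "\<dots> = ennreal (1 / (1 - 2 powr - \<beta>1) * \<rho> + 6 * \<rho>)"
    using p by (intro ennreal_plus[symmetric]) (auto simp: \<rho>_def)
  also have "1 / (1 - 2 powr - \<beta>1) * \<rho> + 6 * \<rho> = (6 + 1 / (1 - 2 powr - \<beta>1)) * \<rho>"
    by (simp only: distrib_right add.commute)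
  finally show ?thesis
    by (simp only: \<rho>_def)
qed

lemma power_max_level_le:
  assumes "1 \<le> n"
  shows "2 ^ max_level n \<le> real n"
proof -
  have "0 \<le> ln (real n) / ln 2" using assms by simp
  then have "real (max_level n) \<le> log 2 (real n)"
    by (simp add: max_level_def log_def)
  then have "2 powr real (max_level n) \<le> 2 powr (log 2 (real n))"
    by (intro powr_mono) auto
  then show ?thesis
    using assms by (simp add: powr_realpow)
qed

lemma less_power_above_max_level:
  assumes "1 \<le> n" "max_level n < j"
  shows "real n < 2 ^ j"
proof -
  have "\<lfloor>ln (real n) / ln 2\<rfloor> < int j"
    using assms unfolding max_level_def by linarith
  then have "log 2 (real n) < real j"
    by (simp add: log_def floor_less_iff)
  then have "2 powr (log 2 (real n)) < 2 powr real j"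
    by simp
  then show ?thesis
    using assms by (simp add: powr_realpow)
qed

definition noise_level :: "nat \<Rightarrow> real" where
  "noise_level n = sqrt (ln (real n) / real n)"

lemma rate_eq_noise_level:
  assumes "2 \<le> n"
  shows "rate M n \<beta> = M * noise_level n powr (2 * \<beta> / (2 * \<beta> + 1))"
proof -
  have pos: "0 < ln (real n) / real n"
    using assms by simp
  have "real n / ln (real n) = (ln (real n) / real n) powr -1"
    using assms by (simp add: powr_minus_divide)
  then have "(real n / ln (real n)) powr (- \<beta> / (2 * \<beta> + 1)) = (ln (real n) / real n) powr (\<beta> / (2 * \<beta> + 1))"
    by (simp only: powr_powr) simp
  moreover have "noise_level n = (ln (real n) / real n) powr (1 / 2)"
    using pos by (simp add: noise_level_def powr_half_sqrt)
  then have "noise_level n powr (2 * \<beta> / (2 * \<beta> + 1)) = (ln (real n) / real n) powr (\<beta> / (2 * \<beta> + 1))"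
    by (simp only: powr_powr) simp
  ultimately show ?thesis
    by (simp add: rate_def)
qed

section \<open>Spike and slab priors on sequences\<close>

text \<open>The density \<open>g\<close> is bounded below on a neighbourhood of radius 1 of the interval \<open>[-L, L]\<close> of
  possible coefficients. The comparison point of the slab, at distance of order \<open>noise_level n\<close> from
  the true coefficient, then stays where \<open>g \<ge> g0\<close> for all large \<open>n\<close>.\<close>

locale spike_slab_model =
  fixes I :: "nat \<Rightarrow> 'k set" and c2 K L g0 :: real
    and g :: "real \<Rightarrow> real" and w :: "nat \<Rightarrow> nat \<Rightarrow> real"
  assumes fin: "\<And>j. finite (I j)" and ne: "\<And>j. I j \<noteq> {}"
    and card_le: "\<And>j. real (card (I j)) \<le> c2 * 2 ^ j"
    and g_meas [measurable]: "g \<in> borel_measurable borel"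
    and g_int: "(\<integral>\<^sup>+x. ennreal (g x) \<partial>lborel) = 1"
    and g0_pos: "0 < g0" and g0_le: "\<And>x. \<bar>x\<bar> \<le> L + 1 \<Longrightarrow> g0 \<le> g x"
    and K_pos: "0 < K" and L_pos: "0 < L"
    and weight_ge: "\<And>n j. 1 \<le> n \<Longrightarrow> j \<le> max_level n \<Longrightarrow> real n powr - K \<le> w j n"
    and weight_le: "\<And>n j. 1 \<le> n \<Longrightarrow> j \<le> max_level n \<Longrightarrow> w j n \<le> real n powr - 6"
begin

text \<open>The cutoff is chosen so that with \<open>t = cutoff * noise_level n\<close> one has
  \<open>exp (- n t\<^sup>2 / 4) = n powr (- (K + 5))\<close>. This beats the factor \<open>n powr K\<close> from \<open>1 / w\<close> with a margin
  that makes each expected excess of order \<open>n powr (- 4)\<close>.\<close>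

definition "cutoff = 2 * sqrt (K + 5)"
text \<open>Coefficients below \<open>null_const * noise_level n\<close> count as small. The constant makes the likelihood
  gain \<open>exp (n a (2 t + a))\<close> of a nearby slab value at most \<open>n\<close>, which the prior weight
  \<open>w \<le> n powr (- 6)\<close> outweighs.\<close>

definition "null_const = 1 / (2 * cutoff + 1)"
definition "excess_const = 2 * (exp (1 / 2) / g0 * (L + 1)) + 4"

text \<open>The conditions on \<open>n\<close> keep the comparison interval of the slab inside \<open>[-(L + 1), L + 1]\<close>, make the
  threshold \<open>t = cutoff * noise_level n\<close> at most 1 and \<open>2 / (n t)\<close> at most 1, and make \<open>noise_level n\<close>
  dominate \<open>1 / sqrt n\<close>.\<close>

definition "large n \<longleftrightarrow> 2 \<le> n \<and> 1 \<le> ln (real n) \<and>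
  cutoff * noise_level n / 2 + 1 / sqrt (real n) \<le> 1 \<and> cutoff * noise_level n \<le> 1 \<and>
  2 \<le> real n * (cutoff * noise_level n)"

lemma cutoff: "0 < cutoff" "cutoff\<^sup>2 = 4 * (K + 5)"
  using K_pos by (auto simp: cutoff_def power_mult_distrib)

lemma null_const: "0 < null_const" "null_const \<le> 1" "null_const * (2 * cutoff + null_const) \<le> 1"
proof -
  show *: "0 < null_const" "null_const \<le> 1"
    using cutoff by (auto simp: null_const_def)
  have "null_const * (2 * cutoff + null_const) \<le> null_const * (2 * cutoff + 1)"
    using * by (intro mult_left_mono) auto
  also have "\<dots> = 1"
    using cutoff by (simp add: null_const_def)
  finally show "null_const * (2 * cutoff + null_const) \<le> 1" .
qed

lemma eventually_large: "eventually large sequentially"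
proof -
  have "eventually (\<lambda>n. 2 \<le> n) sequentially"
    by (rule eventually_ge_at_top)
  moreover have "eventually (\<lambda>n. 1 \<le> ln (real n)) sequentially"
    by real_asymp
  moreover have "(\<lambda>n. cutoff * noise_level n / 2 + 1 / sqrt (real n)) \<longlonglongrightarrow> 0"
    unfolding noise_level_def by real_asymp
  then have "eventually (\<lambda>n. cutoff * noise_level n / 2 + 1 / sqrt (real n) < 1) sequentially"
    by (rule order_tendstoD) simp
  moreover have "(\<lambda>n. cutoff * noise_level n) \<longlonglongrightarrow> 0"
    unfolding noise_level_def by real_asymp
  then have "eventually (\<lambda>n. cutoff * noise_level n < 1) sequentially"
    by (rule order_tendstoD) simp
  moreover have "eventually (\<lambda>n. 2 \<le> real n * (cutoff * noise_level n)) sequentially"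
    unfolding noise_level_def using cutoff(1) by real_asymp
  ultimately show ?thesis
    by eventually_elim (auto simp: large_def)
qed

lemma noise_level:
  assumes "large n"
  shows "0 < noise_level n" "real n * (noise_level n)\<^sup>2 = ln (real n)" "real n powr (- 1 / 2) \<le> noise_level n"
proof -
  have n: "2 \<le> n" "0 < real n" "1 \<le> ln (real n)"
    using assms by (auto simp: large_def)
  then have "0 < ln (real n) / real n"
    by (intro divide_pos_pos) auto
  then show "0 < noise_level n" "real n * (noise_level n)\<^sup>2 = ln (real n)"
    using n by (auto simp: noise_level_def)
  have "real n powr (- 1 / 2) = sqrt (1 / real n)"
    using n by (simp add: powr_minus powr_half_sqrt real_sqrt_divide inverse_eq_divide)
  also have "\<dots> \<le> noise_level n"
    unfolding noise_level_def using n by (intro real_sqrt_le_mono divide_right_mono) auto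
  finally show "real n powr (- 1 / 2) \<le> noise_level n" .
qed

lemma weight_bounds:
  assumes "large n" "j \<le> max_level n"
  shows "0 < w j n" "w j n \<le> 1 / 2"
proof -
  have n: "1 \<le> n" "2 \<le> real n" using assms by (auto simp: large_def)
  have "0 < real n powr - K" using n by simp
  also have "\<dots> \<le> w j n" using n assms by (intro weight_ge)
  finally show "0 < w j n" .
  have "w j n \<le> real n powr - 6" using n assms by (intro weight_le)
  also have "\<dots> \<le> real n powr - 1" using n by (intro powr_mono) auto
  also have "\<dots> \<le> 1 / 2" using n by (simp add: powr_minus_divide)
  finally show "w j n \<le> 1 / 2" .
qed

lemma signal_bound_le:
  assumes n: "large n" and j: "j \<le> max_level n" and m: "\<bar>m\<bar> \<le> L"
    and t: "t = cutoff * noise_level n"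
  shows "exp (1 / 2) * sqrt (real n) / g0 * exp (- real n * t\<^sup>2 / 4) * (\<bar>m\<bar> / w j n + 2 / (real n * t))
    \<le> exp (1 / 2) / g0 * (L + 1) * real n powr - 4"
proof -
  have n': "1 \<le> n" "1 \<le> real n" "0 < real n" using n by (auto simp: large_def)
  have nK: "1 \<le> real n powr K"
    using n' K_pos by (simp add: ge_one_powr_ge_zero)
  have "real n * t\<^sup>2 = (cutoff\<^sup>2) * (real n * (noise_level n)\<^sup>2)"
    by (simp add: t power_mult_distrib)
  then have "real n * t\<^sup>2 = 4 * ((K + 5) * ln (real n))"
    by (simp only: noise_level[OF n] cutoff mult.assoc)
  then have "- real n * t\<^sup>2 / 4 = - ((K + 5) * ln (real n))"
    by simp
  then have "- real n * t\<^sup>2 / 4 = - (K + 5) * ln (real n)"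
    by (simp only: minus_mult_left)
  then have e: "exp (- real n * t\<^sup>2 / 4) = real n powr (- (K + 5))"
    using n' by (simp add: powr_def)
  have "\<bar>m\<bar> / w j n \<le> L / real n powr - K"
    using m L_pos n' weight_ge[OF n'(1) j] by (intro frac_le) auto
  also have "\<dots> = L * real n powr K"
    by (simp add: powr_minus_divide)
  finally have "\<bar>m\<bar> / w j n \<le> L * real n powr K" .
  moreover have "2 / (real n * t) \<le> 1"
    using n by (simp add: large_def t divide_le_eq)
  ultimately have "\<bar>m\<bar> / w j n + 2 / (real n * t) \<le> (L + 1) * real n powr K"
    using nK by (simp add: distrib_right)
  moreover have "sqrt (real n) \<le> real n"
    using n' by (simp add: real_le_lsqrt power2_eq_square)
  ultimately have "exp (1 / 2) * sqrt (real n) / g0 * exp (- real n * t\<^sup>2 / 4) * (\<bar>m\<bar> / w j n + 2 / (real n * t))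
     \<le> exp (1 / 2) * real n / g0 * real n powr (- (K + 5)) * ((L + 1) * real n powr K)"
    unfolding e using g0_pos L_pos by (intro mult_mono divide_right_mono mult_left_mono mult_nonneg_nonneg)
     (use weight_bounds[OF n j] cutoff(1) noise_level(1)[OF n] in \<open>auto simp: t\<close>)
  also have "\<dots> = exp (1 / 2) / g0 * (L + 1) * (real n powr 1 * real n powr (- (K + 5)) * real n powr K)"
    using n' by simp
  also have "real n powr 1 * real n powr (- (K + 5)) * real n powr K = real n powr - 4"
    by (simp only: powr_add[symmetric]) simp
  finally show ?thesis .
qed

text \<open>This is where the extra factor \<open>n powr (- 6)\<close> in the upper bound on the weights is used.\<close>

lemma null_bound_le:
  assumes n: "large n" and j: "j \<le> max_level n" and a: "0 \<le> a" "a \<le> null_const * noise_level n"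
    and t: "t = cutoff * noise_level n"
  shows "w j n * (2 * t) * (exp (real n * (a * (2 * t + a))) / (1 - w j n)) \<le> 4 * real n powr - 4"
proof -
  have n': "1 \<le> n" "1 \<le> real n" "0 < real n" using n by (auto simp: large_def)
  have s: "0 < noise_level n" by (rule noise_level[OF n])
  have t': "0 \<le> t" "t \<le> 1"
    using n s cutoff by (auto simp: t large_def)
  have "a * (2 * t + a) \<le> (null_const * noise_level n) * (2 * t + null_const * noise_level n)"
    using a t' by (intro mult_mono) auto
  also have "\<dots> = null_const * (2 * cutoff + null_const) * (noise_level n)\<^sup>2"
    by (simp add: t power2_eq_square algebra_simps)
  also have "\<dots> \<le> 1 * (noise_level n)\<^sup>2"
    by (intro mult_right_mono null_const) auto
  finally have "real n * (a * (2 * t + a)) \<le> real n * (noise_level n)\<^sup>2"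
    by (intro mult_left_mono) auto
  then have "real n * (a * (2 * t + a)) \<le> ln (real n)"
    by (simp add: noise_level[OF n])
  then have e: "exp (real n * (a * (2 * t + a))) \<le> real n"
    using n' by (metis exp_le_cancel_iff exp_ln)
  have "exp (real n * (a * (2 * t + a))) / (1 - w j n) \<le> real n / (1 / 2)"
    using e weight_bounds[OF n j] n' by (intro frac_le) auto
  then have "w j n * (2 * t) * (exp (real n * (a * (2 * t + a))) / (1 - w j n))
      \<le> real n powr - 6 * 2 * (real n / (1 / 2))"
    using weight_le[OF n'(1) j] weight_bounds[OF n j] t' by (intro mult_mono) auto
  also have "\<dots> = 4 * (real n powr - 6 * real n powr 1)"
    using n' by simp
  also have "\<dots> = 4 * real n powr - 5"
    by (simp only: powr_add[symmetric]) simp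
  also have "\<dots> \<le> 4 * real n powr - 4"
    using n' by (intro mult_left_mono powr_mono) auto
  finally show ?thesis .
qed

section \<open>Level thresholds and the total excess\<close>

text \<open>The largest coefficient at level \<open>j\<close> in the Hoelder ball.\<close>

definition radius :: "real \<Rightarrow> nat \<Rightarrow> real" where
  "radius \<beta> j = L * 2 powr (- real j * (\<beta> + 1 / 2))"

text \<open>Where the coefficients are certainly small, or the prior is degenerate, the threshold is their
  own bound, so that the posterior mass at zero causes no excess; elsewhere it is of the order of the
  noise. Either way it is at most a constant times the smaller of the two.\<close>

definition level_cutoff :: "nat \<Rightarrow> real \<Rightarrow> nat \<Rightarrow> real" where
  "level_cutoff n \<beta> j =
     (if max_level n < j \<or> radius \<beta> j \<le> null_const * noise_level n then radius \<beta> j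
      else cutoff * noise_level n)"

definition level_prior_at :: "nat \<Rightarrow> nat \<times> 'k \<Rightarrow> real measure" where
  "level_prior_at n = (\<lambda>(j, k). if j \<le> max_level n then spike_slab (w j n) g else return borel 0)"

lemma prior_eq: "prior I w g n = PiM (Lam I) (level_prior_at n)"
  by (simp add: prior_def level_prior_at_def)

lemma level_prior_at:
  assumes "large n"
  shows "level_prior I (level_prior_at n) (max_level n)"
proof (rule level_prior.intro)
  fix i :: "nat \<times> 'k"
  show "prob_space (level_prior_at n i)"
    using weight_bounds[OF assms]
    by (cases i) (auto simp: level_prior_at_def prob_space_return less_imp_le order_trans[of _ "1/2" 1]
        intro!: prob_space_spike_slab g_meas g_int)
  show "sets (level_prior_at n i) = sets borel"
    by (cases i) (simp add: level_prior_at_def sets_spike_slab[OF g_meas g_int])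
qed (auto simp: level_prior_at_def fin)

lemma radius: "0 < radius \<beta> j" "0 \<le> \<beta> \<Longrightarrow> radius \<beta> j \<le> L"
proof -
  show "0 < radius \<beta> j" using L_pos by (simp add: radius_def)
  show "radius \<beta> j \<le> L" if "0 \<le> \<beta>"
    using L_pos that powr_mono[of "- real j * (\<beta> + 1 / 2)" 0 2]
    by (simp add: radius_def mult_le_cancel_left1)
qed

lemma level_cutoff_nonneg:
  assumes "large n"
  shows "0 \<le> level_cutoff n \<beta> j"
  using radius(1)[of \<beta> j] noise_level(1)[OF assms] cutoff by (simp add: level_cutoff_def)

lemma expected_excess_le:
  assumes n: "large n" and "0 \<le> \<beta>" and m: "\<bar>m\<bar> \<le> radius \<beta> j" and j: "j \<le> max_level n"
  shows "(\<integral>\<^sup>+x. ennreal (max 0 (\<bar>x - m\<bar> - level_cutoff n \<beta> j)) *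
      expected_post n (spike_slab (w j n) g) m x \<partial>spike_slab (w j n) g)
    \<le> ennreal (excess_const * real n powr - 4)"
proof -
  have n1: "1 \<le> n" using n by (simp add: large_def)
  have w: "0 < w j n" "w j n < 1" "w j n \<le> 1" using weight_bounds[OF n j] by auto
  have mL: "\<bar>m\<bar> \<le> L" using m radius(2)[OF \<open>0 \<le> \<beta>\<close>, of j] by simp
  define t where "t = cutoff * noise_level n"
  have t: "0 < t" "\<bar>m\<bar> + t / 2 + 1 / sqrt (real n) \<le> L + 1"
    using n mL cutoff noise_level(1)[OF n] by (auto simp: t_def large_def)
  have c: "0 \<le> exp (1 / 2) / g0 * (L + 1)"
    using g0_pos L_pos by simp
  note signal = signal_bound_le[OF n j mL t_def]
  show ?thesis
  proof (cases "radius \<beta> j \<le> null_const * noise_level n")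
    case True
    then have "level_cutoff n \<beta> j = radius \<beta> j" by (simp add: level_cutoff_def)
    then have "(\<integral>\<^sup>+x. ennreal (max 0 (\<bar>x - m\<bar> - level_cutoff n \<beta> j)) *
        expected_post n (spike_slab (w j n) g) m x \<partial>spike_slab (w j n) g)
      \<le> ennreal (w j n * (2 * t) * (exp (real n * (radius \<beta> j * (2 * t + radius \<beta> j))) / (1 - w j n)) +
          2 * (exp (1 / 2) * sqrt (real n) / g0 * exp (- real n * t\<^sup>2 / 4) * (\<bar>m\<bar> / w j n + 2 / (real n * t))))"
      using nn_integral_excess_null[OF n1 w(1,2) g_meas g_int g0_pos g0_le t m] by simp
    also have "\<dots> \<le> ennreal (4 * real n powr - 4 + 2 * (exp (1 / 2) / g0 * (L + 1) * real n powr - 4))"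
      by (intro ennreal_leI add_mono mult_left_mono signal
          null_bound_le[OF n j less_imp_le[OF radius(1)] True t_def]) simp
    also have "\<dots> = ennreal (excess_const * real n powr - 4)"
      by (simp add: excess_const_def algebra_simps)
    finally show ?thesis .
  next
    case False
    then have eq: "level_cutoff n \<beta> j = t" using j by (simp add: level_cutoff_def t_def)
    have double: "x \<le> 2 * x + 4" if "0 \<le> x" for x :: real
      using that by simp
    have "exp (1 / 2) / g0 * (L + 1) * real n powr - 4 \<le> excess_const * real n powr - 4"
      unfolding excess_const_def by (intro mult_right_mono double c) simp
    note ennreal_leI[OF order_trans[OF signal this]]
    with nn_integral_excess_signal[OF n1 w(1,3) g_meas g_int g0_pos g0_le t]
    show ?thesis
      unfolding eq by (rule order_trans)
  qed
qed

definition "level_const = (L + 1 + cutoff) + (1 + cutoff / null_const) * L"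

lemma level_const: "0 < level_const"
  using L_pos cutoff null_const by (auto simp: level_const_def intro!: add_pos_nonneg)

text \<open>Above \<open>max_level n\<close> one has \<open>2\<^sup>j > n\<close>, so the radius is at most \<open>L * noise_level n\<close> there too.\<close>

lemma level_cutoff_le:
  assumes n: "large n" and "0 \<le> \<beta>"
  shows "2 powr (real j / 2) * level_cutoff n \<beta> j
    \<le> level_const * min (2 powr (- real j * \<beta>)) (2 powr (real j / 2) * noise_level n)"
proof -
  note s = noise_level[OF n]
  have rad: "radius \<beta> j \<le> L * noise_level n" if "max_level n < j"
  proof -
    have "real n \<le> 2 ^ j"
      using less_power_above_max_level[of n j] n that by (simp add: large_def)
    have "2 powr (- real j * (\<beta> + 1 / 2)) \<le> 2 powr (real j * (- 1 / 2))"
      using \<open>0 \<le> \<beta>\<close> by (intro powr_mono) (auto simp: algebra_simps)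
    also have "\<dots> = (2 ^ j) powr (- 1 / 2)"
      by (simp only: powr_powr[symmetric] powr_realpow)
    also have "\<dots> \<le> real n powr (- 1 / 2)"
      using \<open>real n \<le> 2 ^ j\<close> n by (intro powr_mono2') (auto simp: large_def)
    also have "\<dots> \<le> noise_level n" by (rule s)
    finally show ?thesis
      using L_pos by (simp add: radius_def)
  qed
  have noise: "level_cutoff n \<beta> j \<le> (L + 1 + cutoff) * noise_level n"
  proof -
    have "radius \<beta> j \<le> noise_level n" if "radius \<beta> j \<le> null_const * noise_level n"
      using that mult_right_mono[OF null_const(2) less_imp_le[OF s(1)]] by linarith
    moreover have "0 \<le> L * noise_level n" "0 \<le> cutoff * noise_level n"
      using L_pos cutoff s by auto
    ultimately show ?thesis
      using rad s by (auto simp: level_cutoff_def distrib_right) 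
  qed
  have rad': "level_cutoff n \<beta> j \<le> (1 + cutoff / null_const) * radius \<beta> j"
  proof -
    have "cutoff * noise_level n \<le> cutoff * (radius \<beta> j / null_const)"
      if "null_const * noise_level n < radius \<beta> j"
      using that cutoff null_const by (intro mult_left_mono) (auto simp: field_simps)
    moreover have "0 \<le> cutoff / null_const * radius \<beta> j"
      using cutoff null_const radius(1)[of \<beta> j] by auto
    ultimately show ?thesis
      using radius(1)[of \<beta> j] by (auto simp: level_cutoff_def distrib_right not_le)
  qed
  have eq: "2 powr (real j / 2) * radius \<beta> j = L * 2 powr (- real j * \<beta>)"
    by (simp add: radius_def mult.left_commute[of _ L] powr_add[symmetric]) (simp add: field_simps)
  have "2 powr (real j / 2) * level_cutoff n \<beta> j
      \<le> 2 powr (real j / 2) * ((1 + cutoff / null_const) * radius \<beta> j)"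
    by (intro mult_left_mono rad') simp
  also have "\<dots> = (1 + cutoff / null_const) * (2 powr (real j / 2) * radius \<beta> j)"
    by (rule mult.left_commute)
  also have "\<dots> = (1 + cutoff / null_const) * L * 2 powr (- real j * \<beta>)"
    by (simp only: eq mult.assoc)
  also have "\<dots> \<le> level_const * 2 powr (- real j * \<beta>)"
    using L_pos cutoff by (intro mult_right_mono) (auto simp: level_const_def)
  finally have 1: "2 powr (real j / 2) * level_cutoff n \<beta> j \<le> level_const * 2 powr (- real j * \<beta>)" .
  have "2 powr (real j / 2) * level_cutoff n \<beta> j
      \<le> 2 powr (real j / 2) * ((L + 1 + cutoff) * noise_level n)"
    by (intro mult_left_mono noise) simp
  also have "\<dots> = (L + 1 + cutoff) * (2 powr (real j / 2) * noise_level n)"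
    by (rule mult.left_commute)
  also have "\<dots> \<le> level_const * (2 powr (real j / 2) * noise_level n)"
    using L_pos cutoff null_const s by (intro mult_right_mono) (auto simp: level_const_def)
  finally show ?thesis
    using 1 by (simp add: min_def)
qed

lemma suminf_level_cutoff_le:
  assumes n: "large n" and \<beta>: "0 < \<beta>1" "\<beta>1 \<le> \<beta>"
  shows "(\<Sum>j. ennreal (2 powr (real j / 2) * level_cutoff n \<beta> j))
    \<le> ennreal (level_const * (6 + 1 / (1 - 2 powr - \<beta>1)) * rate 1 n \<beta>)"
proof -
  have "(\<Sum>j. ennreal (2 powr (real j / 2) * level_cutoff n \<beta> j))
    \<le> (\<Sum>j. ennreal level_const * ennreal (min (2 powr (- real j * \<beta>)) (2 powr (real j / 2) * noise_level n)))"
    using level_cutoff_le[OF n, of \<beta>] \<beta> level_const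
    by (intro suminf_le) (auto simp: ennreal_mult'[symmetric] intro!: ennreal_leI)
  also have "\<dots> \<le> ennreal level_const * ennreal ((6 + 1 / (1 - 2 powr - \<beta>1)) *
      noise_level n powr (2 * \<beta> / (2 * \<beta> + 1)))"
    using suminf_min_powr_le[OF noise_level(1)[OF n] \<beta>] by (simp add: mult_left_mono)
  also have "\<dots> = ennreal (level_const * (6 + 1 / (1 - 2 powr - \<beta>1)) * rate 1 n \<beta>)"
    using level_const n by (simp add: ennreal_mult'[symmetric] rate_eq_noise_level large_def mult.assoc)
  finally show ?thesis .
qed

text \<open>The part of the posterior mean loss above the thresholds. It is a function of the data, and its
  mean turns out to be of order \<open>1 / n\<close>, which is negligible against every rate considered.\<close>

definition total_excess :: "nat \<Rightarrow> real \<Rightarrow> (nat \<times> 'k \<Rightarrow> real) \<Rightarrow> (nat \<times> 'k \<Rightarrow> real) \<Rightarrow> ennreal" where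
  "total_excess n \<beta> \<theta> y = (\<Sum>j. ennreal (2 powr (real j / 2)) *
      (\<Sum>k\<in>I j. coord_post n (level_prior_at n (j, k))
        (\<lambda>x. ennreal (max 0 (\<bar>x - \<theta> (j, k)\<bar> - level_cutoff n \<beta> j))) (y (j, k))))"

lemma measurable_coord_post_at:
  assumes n: "large n" and "k \<in> I j" and "f \<in> borel_measurable borel"
  shows "(\<lambda>y. coord_post n (level_prior_at n (j, k)) f (y (j, k))) \<in> borel_measurable (white_noise I n \<theta>)"
proof -
  interpret level_prior I "level_prior_at n" "max_level n" by (rule level_prior_at[OF n])
  have "(\<lambda>y. y (j, k)) \<in> measurable (white_noise I n \<theta>) borel"
    using assms(2) unfolding white_noise_def
    by (subst measurable_cong_sets[OF _ refl, of _ "seq_space I"])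
       (auto intro!: measurable_component_singleton sets_PiM_cong simp: Lam_def)
  then show ?thesis
    using measurable_coord_post[OF prob sets_mu assms(3)] by (rule measurable_compose)
qed

lemma measurable_total_excess:
  assumes n: "large n"
  shows "total_excess n \<beta> \<theta> \<in> borel_measurable (white_noise I n \<theta>')"
proof -
  have [measurable]: "(\<lambda>y. coord_post n (level_prior_at n (j, k))
      (\<lambda>x. ennreal (max 0 (\<bar>x - \<theta> (j, k)\<bar> - level_cutoff n \<beta> j))) (y (j, k)))
      \<in> borel_measurable (white_noise I n \<theta>')" if "k \<in> I j" for j k
    using n that by (intro measurable_coord_post_at) auto
  show ?thesis
    unfolding total_excess_def[abs_def] by measurable
qed

lemma expected_coord_excess_le:
  assumes n: "large n" and "0 \<le> \<beta>" and \<theta>: "\<theta> \<in> holder_ball I \<beta> L" and k: "k \<in> I j"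
  shows "(\<integral>\<^sup>+y. coord_post n (level_prior_at n (j, k))
        (\<lambda>x. ennreal (max 0 (\<bar>x - \<theta> (j, k)\<bar> - level_cutoff n \<beta> j))) (y (j, k)) \<partial>white_noise I n \<theta>)
    \<le> (if j \<le> max_level n then ennreal (excess_const * real n powr - 4) else 0)"
proof -
  interpret level_prior I "level_prior_at n" "max_level n" by (rule level_prior_at[OF n])
  have n1: "1 \<le> n" using n by (simp add: large_def)
  have i: "(j, k) \<in> Lam I" using k by (simp add: Lam_def)
  let ?f = "\<lambda>x. ennreal (max 0 (\<bar>x - \<theta> (j, k)\<bar> - level_cutoff n \<beta> j))"
  let ?N = "noise n (\<theta> (j, k))"
  have m: "\<bar>\<theta> (j, k)\<bar> \<le> radius \<beta> j"
    using \<theta> i by (auto simp: holder_ball_def radius_def)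
  have "(\<integral>\<^sup>+y. coord_post n (level_prior_at n (j, k)) ?f (y (j, k)) \<partial>white_noise I n \<theta>)
    = (\<integral>\<^sup>+z. coord_post n (level_prior_at n (j, k)) ?f z \<partial>distr (white_noise I n \<theta>) ?N (\<lambda>y. y (j, k)))"
    unfolding white_noise_def using i
    by (intro nn_integral_distr[symmetric])
       (auto intro!: measurable_component_singleton measurable_coord_post prob sets_mu
         simp: measurable_cong_sets[OF sets_density refl])
  also have "distr (white_noise I n \<theta>) ?N (\<lambda>y. y (j, k)) = ?N"
    unfolding white_noise_def using i prob_space_noise[OF n1] by (subst distr_PiM_component) auto
  also have "(\<integral>\<^sup>+z. coord_post n (level_prior_at n (j, k)) ?f z \<partial>?N)
    = (\<integral>\<^sup>+x. ?f x * expected_post n (level_prior_at n (j, k)) (\<theta> (j, k)) x \<partial>level_prior_at n (j, k))"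
    by (intro nn_integral_coord_post n1 prob sets_mu) measurable
  also have "\<dots> \<le> (if j \<le> max_level n then ennreal (excess_const * real n powr - 4) else 0)"
  proof (cases "j \<le> max_level n")
    case True
    then show ?thesis
      using expected_excess_le[OF n \<open>0 \<le> \<beta>\<close> m True] by (simp add: level_prior_at_def)
  next
    case False
    have [measurable]: "expected_post n (return borel 0) (\<theta> (j, k)) \<in> borel_measurable borel"
      by (intro measurable_expected_post n1 prob_space_return) auto
    show ?thesis
      using False m by (simp add: level_prior_at_def nn_integral_return level_cutoff_def max_def)
  qed
  finally show ?thesis .
qed

text \<open>There are at most \<open>n\<close> levels with at most \<open>c2 * n\<close> coefficients each, the loss weights are at most
  \<open>n\<close>, and each coefficient contributes at most a constant times \<open>n powr (- 4)\<close>.\<close>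

lemma expected_total_excess_le:
  assumes n: "large n" and "0 \<le> \<beta>" and \<theta>: "\<theta> \<in> holder_ball I \<beta> L"
  shows "(\<integral>\<^sup>+y. total_excess n \<beta> \<theta> y \<partial>white_noise I n \<theta>) \<le> ennreal (c2 * excess_const / real n)"
proof -
  define J where "J = max_level n"
  define c where "c = excess_const * real n powr - 4"
  have n1: "1 \<le> n" and n': "0 < real n" using n by (auto simp: large_def)
  have ex: "0 \<le> excess_const" using g0_pos L_pos by (simp add: excess_const_def)
  then have c: "0 \<le> c" by (simp add: c_def)
  have c2: "0 \<le> c2" using card_le[of 0] by simp
  define h where "h j k y = coord_post n (level_prior_at n (j, k))
      (\<lambda>x. ennreal (max 0 (\<bar>x - \<theta> (j, k)\<bar> - level_cutoff n \<beta> j))) (y (j, k))" for j k y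
  have [measurable]: "h j k \<in> borel_measurable (white_noise I n \<theta>)" if "k \<in> I j" for j k
    unfolding h_def[abs_def] using n that by (intro measurable_coord_post_at) auto
  have "(\<integral>\<^sup>+y. total_excess n \<beta> \<theta> y \<partial>white_noise I n \<theta>)
    = (\<integral>\<^sup>+y. (\<Sum>j. ennreal (2 powr (real j / 2)) * (\<Sum>k\<in>I j. h j k y)) \<partial>white_noise I n \<theta>)"
    by (simp only: total_excess_def h_def)
  also have "\<dots> = (\<Sum>j. ennreal (2 powr (real j / 2)) * (\<Sum>k\<in>I j. \<integral>\<^sup>+y. h j k y \<partial>white_noise I n \<theta>))"
    by (simp add: nn_integral_suminf nn_integral_cmult nn_integral_sum)
  also have "\<dots> \<le> (\<Sum>j. ennreal (2 powr (real j / 2)) * (\<Sum>k\<in>I j. if j \<le> J then ennreal c else 0))"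
    unfolding J_def c_def h_def
    by (intro suminf_le mult_left_mono sum_mono expected_coord_excess_le n \<theta> \<open>0 \<le> \<beta>\<close> summableI zero_le)
  also have "\<dots> = (\<Sum>j\<le>J. ennreal (2 powr (real j / 2)) * (\<Sum>k\<in>I j. if j \<le> J then ennreal c else 0))"
    by (intro suminf_finite) auto
  also have "\<dots> = (\<Sum>j\<le>J. ennreal (2 powr (real j / 2) * (real (card (I j)) * c)))"
    using c by (intro sum.cong) (auto simp: ennreal_mult ennreal_of_nat_eq_real_of_nat)
  also have "\<dots> = ennreal (\<Sum>j\<le>J. 2 powr (real j / 2) * (real (card (I j)) * c))"
    using c by (intro sum_ennreal) auto
  also have "\<dots> \<le> ennreal (\<Sum>j\<le>J. real n * (c2 * real n * c))"
  proof (intro ennreal_leI sum_mono mult_mono)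
    fix j assume "j \<in> {..J}"
    then have "2 ^ j \<le> (2 ^ J :: real)" by simp
    also have "\<dots> \<le> real n" unfolding J_def by (rule power_max_level_le[OF n1])
    finally have *: "2 ^ j \<le> real n" .
    have "2 powr (real j / 2) \<le> 2 powr real j" by (intro powr_mono) auto
    also have "\<dots> = 2 ^ j" by (simp add: powr_realpow)
    finally show "2 powr (real j / 2) \<le> real n" using * by linarith
    have "c2 * 2 ^ j \<le> c2 * real n" using * c2 by (rule mult_left_mono)
    then show "real (card (I j)) \<le> c2 * real n" using card_le[of j] by linarith
  qed (use c c2 in auto)
  also have "\<dots> \<le> ennreal (real n * (real n * (c2 * real n * c)))"
  proof (intro ennreal_leI)
    have "real (Suc J) \<le> 2 ^ J"
      using of_nat_mono[OF Suc_leI[OF less_exp[of J]], where 'a = real] by simp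
    also have "\<dots> \<le> real n" unfolding J_def by (rule power_max_level_le[OF n1])
    finally show "(\<Sum>j\<le>J. real n * (c2 * real n * c)) \<le> real n * (real n * (c2 * real n * c))"
      using c c2 by (simp add: mult_right_mono)
  qed
  also have "real n * (real n * (c2 * real n * c)) = c2 * excess_const * (real n powr 3 * real n powr - 4)"
    using n' by (simp add: c_def power3_eq_cube)
  also have "real n powr 3 * real n powr - 4 = 1 / real n"
    using n' by (simp only: powr_add[symmetric]) (simp add: powr_minus_divide)
  finally show ?thesis by simp
qed

section \<open>Probability and expectation bounds\<close>

definition "risk_const \<beta>1 = 2 * (level_const * (6 + 1 / (1 - 2 powr - \<beta>1)))"

lemma risk_const:
  assumes "0 < \<beta>1"
  shows "0 < risk_const \<beta>1"
proof -
  have "2 powr - \<beta>1 < 2 powr (0::real)" using assms by (intro powr_less_mono) auto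
  then show ?thesis
    using level_const by (auto simp: risk_const_def intro!: mult_pos_pos add_pos_nonneg)
qed

lemma AE_bayes_loss_le:
  assumes n: "large n" and \<beta>: "0 < \<beta>1" "\<beta>1 \<le> \<beta>" and \<theta>: "\<theta> \<in> holder_ball I \<beta> L"
    and T: "bayes_estimator I (prior I w g n) n T"
  shows "AE y in white_noise I n \<theta>.
    loss I (T y) \<theta> \<le> ennreal (risk_const \<beta>1 * rate 1 n \<beta>) + 2 * total_excess n \<beta> \<theta> y"
proof -
  interpret level_prior I "level_prior_at n" "max_level n" by (rule level_prior_at[OF n])
  have \<theta>2: "\<theta> \<in> ell2 I" using \<theta> by (simp add: holder_ball_def)
  have "AE y in white_noise I n \<theta>.
      is_arg_min (posterior_risk I (prior I w g n) n y) (\<lambda>\<delta>. \<delta> \<in> ell2 I) (T y)"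
    using T \<theta>2 by (simp add: bayes_estimator_def)
  then show ?thesis
  proof eventually_elim
    fix y assume "is_arg_min (posterior_risk I (prior I w g n) n y) (\<lambda>\<delta>. \<delta> \<in> ell2 I) (T y)"
    then have "loss I (T y) \<theta> \<le> 2 * posterior_risk I (PiM (Lam I) (level_prior_at n)) n y \<theta>"
      using ne \<theta>2 by (intro loss_bayes_le) (auto simp: prior_eq)
    also have "\<dots> \<le> 2 * ((\<Sum>j. ennreal (2 powr (real j / 2) * level_cutoff n \<beta> j)) + total_excess n \<beta> \<theta> y)"
      unfolding total_excess_def using ne level_cutoff_nonneg[OF n]
      by (intro mult_left_mono posterior_risk_le) auto
    also have "\<dots> \<le> 2 * (ennreal (level_const * (6 + 1 / (1 - 2 powr - \<beta>1)) * rate 1 n \<beta>) + total_excess n \<beta> \<theta> y)"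
      using suminf_level_cutoff_le[OF n \<beta>] by (intro mult_left_mono add_right_mono) auto
    also have "\<dots> = ennreal (risk_const \<beta>1 * rate 1 n \<beta>) + 2 * total_excess n \<beta> \<theta> y"
    proof -
      have "risk_const \<beta>1 * rate 1 n \<beta> = 2 * (level_const * (6 + 1 / (1 - 2 powr - \<beta>1)) * rate 1 n \<beta>)"
        by (simp only: risk_const_def mult.assoc)
      moreover have "2 * (ennreal x + X) = ennreal (2 * x) + 2 * X" for x X
        by (simp add: distrib_left ennreal_mult')
      ultimately show ?thesis
        by (simp only:)
    qed
    finally show "loss I (T y) \<theta> \<le> ennreal (risk_const \<beta>1 * rate 1 n \<beta>) + 2 * total_excess n \<beta> \<theta> y" .
  qed
qed

text \<open>The exponent \<open>\<beta> / (2 \<beta> + 1)\<close> stays below \<open>1 / 2\<close>.\<close>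

lemma rate_ge:
  assumes n: "large n" and "0 \<le> \<beta>"
  shows "1 / sqrt (real n) \<le> rate 1 n \<beta>"
proof -
  have n': "2 \<le> n" "1 \<le> real n" "1 \<le> ln (real n)" "0 < real n" using n by (auto simp: large_def)
  have lnn: "ln (real n) \<le> real n" using n' ln_le_minus_one[of "real n"] by simp
  have "1 / sqrt (real n) = real n powr (- 1 / 2)"
    using n' by (simp add: powr_minus_divide powr_half_sqrt)
  also have "\<dots> \<le> (real n / ln (real n)) powr (- 1 / 2)"
    using n' by (intro powr_mono2') (auto simp: divide_le_eq)
  also have "\<dots> \<le> (real n / ln (real n)) powr (- \<beta> / (2 * \<beta> + 1))"
    using n' lnn \<open>0 \<le> \<beta>\<close> by (intro powr_mono) (auto simp: field_simps)
  finally show ?thesis by (simp add: rate_def)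
qed

text \<open>The deterministic part of the loss bound stays one multiple \<open>rate 1 n \<beta>\<close> below the threshold, so a large loss
  forces the excess to be of the order of the rate; Markov's inequality then suffices, because the mean
  excess is of smaller order.\<close>

lemma emeasure_bayes_loss_ge:
  assumes n: "large n" and \<beta>: "0 < \<beta>1" "\<beta>1 \<le> \<beta>" and \<theta>: "\<theta> \<in> holder_ball I \<beta> L"
    and T: "bayes_estimator I (prior I w g n) n T"
  shows "emeasure (white_noise I n \<theta>) {y \<in> space (white_noise I n \<theta>).
      ennreal (rate (risk_const \<beta>1 + 1) n \<beta>) \<le> loss I (T y) \<theta>}
    \<le> ennreal (2 * (c2 * excess_const) / sqrt (real n))"
proof -
  let ?P = "white_noise I n \<theta>"
  let ?X = "\<lambda>y. 2 * total_excess n \<beta> \<theta> y"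
  define \<rho> where "\<rho> = rate 1 n \<beta>"
  have n': "0 < real n" using n by (simp add: large_def)
  have c: "0 \<le> c2 * excess_const"
    using card_le[of 0] g0_pos L_pos by (simp add: excess_const_def)
  have \<rho>: "1 / sqrt (real n) \<le> \<rho>"
    unfolding \<rho>_def using \<beta> by (intro rate_ge n) auto
  moreover have "0 < 1 / sqrt (real n)" using n' by simp
  ultimately have \<rho>0: "0 < \<rho>" by linarith
  have [measurable]: "total_excess n \<beta> \<theta> \<in> borel_measurable ?P"
    by (rule measurable_total_excess[OF n])
  have "emeasure ?P {y \<in> space ?P. ennreal (rate (risk_const \<beta>1 + 1) n \<beta>) \<le> loss I (T y) \<theta>}
    \<le> emeasure ?P {y \<in> space ?P. 1 \<le> ennreal (1 / \<rho>) * ?X y}"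
  proof (rule emeasure_mono_AE)
    show "AE y in ?P. y \<in> {y \<in> space ?P. ennreal (rate (risk_const \<beta>1 + 1) n \<beta>) \<le> loss I (T y) \<theta>} \<longrightarrow>
       y \<in> {y \<in> space ?P. 1 \<le> ennreal (1 / \<rho>) * ?X y}"
      using AE_bayes_loss_le[OF n \<beta> \<theta> T]
    proof eventually_elim
      fix y assume *: "loss I (T y) \<theta> \<le> ennreal (risk_const \<beta>1 * rate 1 n \<beta>) + ?X y"
      have "1 \<le> ennreal (1 / \<rho>) * ?X y" if "ennreal (rate (risk_const \<beta>1 + 1) n \<beta>) \<le> loss I (T y) \<theta>"
      proof -
        have "rate (risk_const \<beta>1 + 1) n \<beta> = risk_const \<beta>1 * \<rho> + \<rho>"
          by (simp add: \<rho>_def rate_def algebra_simps)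
        then have "ennreal (risk_const \<beta>1 * \<rho>) + ennreal \<rho> \<le> ennreal (risk_const \<beta>1 * \<rho>) + ?X y"
          using order_trans[OF that *] risk_const[OF \<beta>(1)] \<rho>0 by (simp add: \<rho>_def[symmetric])
        then have "ennreal \<rho> \<le> ?X y"
          by (simp add: ennreal_add_left_cancel_le)
        then have "ennreal (1 / \<rho>) * ennreal \<rho> \<le> ennreal (1 / \<rho>) * ?X y"
          by (rule mult_left_mono) simp
        then show ?thesis
          using \<rho>0 by (simp add: ennreal_mult'[symmetric])
      qed
      then show "y \<in> {y \<in> space ?P. ennreal (rate (risk_const \<beta>1 + 1) n \<beta>) \<le> loss I (T y) \<theta>} \<longrightarrow>
         y \<in> {y \<in> space ?P. 1 \<le> ennreal (1 / \<rho>) * ?X y}" by auto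
    qed
  qed measurable
  also have "\<dots> \<le> ennreal (1 / \<rho>) * (\<integral>\<^sup>+y. ?X y \<partial>?P)"
    using nn_integral_Markov_inequality[of ?X "space ?P" ?P "ennreal (1 / \<rho>)"] by simp
  also have "(\<integral>\<^sup>+y. ?X y \<partial>?P) \<le> 2 * ennreal (c2 * excess_const / real n)"
    using expected_total_excess_le[OF n _ \<theta>] \<beta> by (simp add: nn_integral_cmult mult_left_mono)
  also have "ennreal (1 / \<rho>) * (2 * ennreal (c2 * excess_const / real n))
      = ennreal (1 / \<rho> * (2 * (c2 * excess_const / real n)))"
    using \<rho>0 c by (simp add: ennreal_mult'[symmetric] ennreal_numeral[symmetric] del: ennreal_numeral)
  also have "\<dots> \<le> ennreal (sqrt (real n) * (2 * (c2 * excess_const / real n)))"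
  proof (intro ennreal_leI mult_right_mono)
    have "1 / \<rho> \<le> 1 / (1 / sqrt (real n))"
      using \<rho> n' by (intro divide_left_mono) (use \<rho>0 in auto)
    then show "1 / \<rho> \<le> sqrt (real n)" by simp
  qed (use c n' in auto)
  also have "sqrt (real n) * (2 * (c2 * excess_const / real n)) = 2 * (c2 * excess_const) / sqrt (real n)"
  proof -
    have "sqrt (real n) * (2 * (c2 * excess_const / real n)) = 2 * (c2 * excess_const) * (sqrt (real n) / real n)"
      by simp
    also have "sqrt (real n) / real n = 1 / sqrt (real n)"
      by (simp add: sqrt_divide_self_eq inverse_eq_divide)
    finally show ?thesis by simp
  qed
  finally show ?thesis by (simp add: mult_left_mono)
qed

lemma nn_integral_bayes_loss_le:
  assumes n: "large n" and \<beta>: "0 < \<beta>1" "\<beta>1 \<le> \<beta>" and \<theta>: "\<theta> \<in> holder_ball I \<beta> L"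
    and T: "bayes_estimator I (prior I w g n) n T"
  shows "(\<integral>\<^sup>+y. loss I (T y) \<theta> \<partial>white_noise I n \<theta>)
    \<le> ennreal ((risk_const \<beta>1 + 2 * (c2 * excess_const)) * rate 1 n \<beta>)"
proof -
  let ?P = "white_noise I n \<theta>"
  have n1: "1 \<le> n" "1 \<le> real n" using n by (auto simp: large_def)
  interpret prob_space ?P
    unfolding white_noise_def by (intro prob_space_PiM prob_space_noise n1)
  have c: "0 \<le> c2 * excess_const"
    using card_le[of 0] g0_pos L_pos by (simp add: excess_const_def)
  have \<rho>: "1 / sqrt (real n) \<le> rate 1 n \<beta>"
    using \<beta> by (intro rate_ge n) auto
  have "sqrt (real n) \<le> real n"
    using n1 by (simp add: real_le_lsqrt power2_eq_square)
  then have "1 / real n \<le> 1 / sqrt (real n)"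
    using n1 by (intro divide_left_mono) auto
  with \<rho> have \<rho>': "1 / real n \<le> rate 1 n \<beta>" by simp
  have [measurable]: "total_excess n \<beta> \<theta> \<in> borel_measurable ?P"
    by (rule measurable_total_excess[OF n])
  have "(\<integral>\<^sup>+y. loss I (T y) \<theta> \<partial>?P)
      \<le> (\<integral>\<^sup>+y. ennreal (risk_const \<beta>1 * rate 1 n \<beta>) + 2 * total_excess n \<beta> \<theta> y \<partial>?P)"
    by (rule nn_integral_mono_AE[OF AE_bayes_loss_le[OF n \<beta> \<theta> T]])
  also have "\<dots> = ennreal (risk_const \<beta>1 * rate 1 n \<beta>) + 2 * (\<integral>\<^sup>+y. total_excess n \<beta> \<theta> y \<partial>?P)"
    by (simp add: nn_integral_add nn_integral_cmult emeasure_space_1)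
  also have "\<dots> \<le> ennreal (risk_const \<beta>1 * rate 1 n \<beta>) + 2 * ennreal (c2 * excess_const / real n)"
    using expected_total_excess_le[OF n _ \<theta>] \<beta> by (intro add_left_mono mult_left_mono) auto
  also have "\<dots> \<le> ennreal (risk_const \<beta>1 * rate 1 n \<beta>) + 2 * ennreal (c2 * excess_const * rate 1 n \<beta>)"
    using mult_left_mono[OF \<rho>' c] by (intro add_left_mono mult_left_mono ennreal_leI) auto
  also have "\<dots> = ennreal ((risk_const \<beta>1 + 2 * (c2 * excess_const)) * rate 1 n \<beta>)"
  proof -
    have \<rho>0: "0 \<le> rate 1 n \<beta>" by (simp add: rate_def)
    have "ennreal (risk_const \<beta>1 * rate 1 n \<beta> + 2 * (c2 * excess_const * rate 1 n \<beta>))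
        = ennreal (risk_const \<beta>1 * rate 1 n \<beta>) + ennreal (2 * (c2 * excess_const * rate 1 n \<beta>))"
      using mult_nonneg_nonneg[OF c \<rho>0] mult_nonneg_nonneg[OF less_imp_le[OF risk_const[OF \<beta>(1)]] \<rho>0]
      by (intro ennreal_plus) auto
    moreover have "ennreal (2 * (c2 * excess_const * rate 1 n \<beta>)) = 2 * ennreal (c2 * excess_const * rate 1 n \<beta>)"
      by (simp add: ennreal_mult'[of 2])
    moreover have "risk_const \<beta>1 * rate 1 n \<beta> + 2 * (c2 * excess_const * rate 1 n \<beta>)
        = (risk_const \<beta>1 + 2 * (c2 * excess_const)) * rate 1 n \<beta>"
      by (simp only: distrib_right mult.assoc)
    ultimately show ?thesis by simp
  qed
  finally show ?thesis .
qed

end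

section \<open>Adaptive rates for the Bayes estimator\<close>

theorem proposition4:
  fixes I :: "nat \<Rightarrow> 'k set" and c1 c2 :: real
    and g :: "real \<Rightarrow> real" and w :: "nat \<Rightarrow> nat \<Rightarrow> real" and L0 K \<tau> :: real
    and \<theta>hat :: "nat \<Rightarrow> (nat \<times> 'k \<Rightarrow> real) \<Rightarrow> (nat \<times> 'k \<Rightarrow> real)"
    and \<beta>1 \<beta>2 L :: real
  assumes "0 < c1" and "c1 \<le> c2"
    and "\<And>j. finite (I j)"
    and "\<And>j. c1 * 2 ^ j \<le> real (card (I j)) \<and> real (card (I j)) \<le> c2 * 2 ^ j"
    and "L0 > 0"
    and "g \<in> borel_measurable borel" and "\<And>x. 0 \<le> g x" and "bdd_above (range g)"
    and "(\<integral>\<^sup>+x. ennreal (g x) \<partial>lborel) = 1"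
    and "(INF x\<in>{-L0..L0}. g x) > 0"
    and "K > 0" and "\<tau> > 1 / 2"
    and "\<And>n j. 1 \<le> n \<Longrightarrow> j \<le> max_level n \<Longrightarrow>
           real n powr (- K) \<le> w j n \<and> w j n \<le> 2 powr (- real j * (1 + \<tau>))"
    and "\<And>n j. 1 \<le> n \<Longrightarrow> j \<le> max_level n \<Longrightarrow>
           w j n \<le> real n powr (- 6) * 2 powr (- real j * (1 + \<tau>))"
    and "\<And>n. 1 \<le> n \<Longrightarrow> bayes_estimator I (prior I w g n) n (\<theta>hat n)"
    and "0 < \<beta>1" and "\<beta>1 \<le> \<beta>2" and "0 < L" and "L \<le> L0 - 1"
  shows "\<exists>M>0.
    (\<lambda>n. SUP \<beta>\<in>{\<beta>1..\<beta>2}. SUP \<theta>0\<in>holder_ball I \<beta> L.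
        emeasure (white_noise I n \<theta>0)
          {y \<in> space (white_noise I n \<theta>0). loss I (\<theta>hat n y) \<theta>0 \<ge> ennreal (rate M n \<beta>)})
      \<longlonglongrightarrow> 0 \<and>
    limsup (\<lambda>n. SUP \<beta>\<in>{\<beta>1..\<beta>2}. inverse (ennreal (rate M n \<beta>)) *
        (SUP \<theta>0\<in>holder_ball I \<beta> L. \<integral>\<^sup>+y. loss I (\<theta>hat n y) \<theta>0 \<partial>white_noise I n \<theta>0)) < \<infinity>"
proof -
  \<comment> \<open>since \<open>L + 1 \<le> L0\<close>, this bounds the density on \<open>[-(L + 1), L + 1]\<close>\<close>
  define g0 where "g0 = (INF x\<in>{-L0..L0}. g x)"
  interpret spike_slab_model I c2 K L g0 g w
  proof
    show "I j \<noteq> {}" for j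
    proof
      assume "I j = {}"
      then have "c1 * 2 ^ j \<le> 0" using assms(4)[of j] by simp
      moreover have "0 < c1 * 2 ^ j" using \<open>0 < c1\<close> by simp
      ultimately show False by linarith
    qed
    show "0 < g0" using assms(10) by (simp add: g0_def)
    show "g0 \<le> g x" if "\<bar>x\<bar> \<le> L + 1" for x
      unfolding g0_def using that assms(7,19)
      by (intro cINF_lower bdd_belowI2[where m = 0]) auto
    show "w j n \<le> real n powr - 6" if "1 \<le> n" "j \<le> max_level n" for n j
    proof -
      have "w j n \<le> real n powr - 6 * 2 powr (- real j * (1 + \<tau>))"
        using assms(14)[OF that] .
      also have "\<dots> \<le> real n powr - 6 * 1"
        using assms(12) powr_mono[of "- real j * (1 + \<tau>)" 0 2] by (intro mult_left_mono) auto
      finally show ?thesis by simp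
    qed
  qed (use assms in auto)
  define M where "M = risk_const \<beta>1 + 1"
  have M: "0 < M" using risk_const[OF \<open>0 < \<beta>1\<close>] by (simp add: M_def)
  define C where "C = risk_const \<beta>1 + 2 * (c2 * excess_const)"
  have C: "0 \<le> C"
    using risk_const[OF \<open>0 < \<beta>1\<close>] card_le[of 0] g0_pos L_pos by (simp add: C_def excess_const_def)
  let ?p = "\<lambda>n. SUP \<beta>\<in>{\<beta>1..\<beta>2}. SUP \<theta>0\<in>holder_ball I \<beta> L.
        emeasure (white_noise I n \<theta>0)
          {y \<in> space (white_noise I n \<theta>0). loss I (\<theta>hat n y) \<theta>0 \<ge> ennreal (rate M n \<beta>)}"
  let ?r = "\<lambda>n. SUP \<beta>\<in>{\<beta>1..\<beta>2}. inverse (ennreal (rate M n \<beta>)) *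
        (SUP \<theta>0\<in>holder_ball I \<beta> L. \<integral>\<^sup>+y. loss I (\<theta>hat n y) \<theta>0 \<partial>white_noise I n \<theta>0)"
  have bayes: "bayes_estimator I (prior I w g n) n (\<theta>hat n)" if "large n" for n
    using that by (intro assms(15)) (simp add: large_def)
  have "?p \<longlonglongrightarrow> 0"
  proof (rule tendsto_sandwich[OF _ _ tendsto_const])
    show "\<forall>\<^sub>F n in sequentially. ?p n \<le> ennreal (2 * (c2 * excess_const) / sqrt (real n))"
      using eventually_large
    proof eventually_elim
      case (elim n)
      then show ?case
        unfolding M_def using \<open>0 < \<beta>1\<close>
        by (intro SUP_least emeasure_bayes_loss_ge bayes) auto
    qed
    have "(\<lambda>n. 2 * (c2 * excess_const) / sqrt (real n)) \<longlonglongrightarrow> 0"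
      by real_asymp
    then show "(\<lambda>n. ennreal (2 * (c2 * excess_const) / sqrt (real n))) \<longlonglongrightarrow> 0"
      using tendsto_ennrealI by fastforce
  qed simp
  moreover have "limsup ?r \<le> ennreal (C / M)"
  proof (rule Limsup_bounded)
    show "\<forall>\<^sub>F n in sequentially. ?r n \<le> ennreal (C / M)"
      using eventually_large
    proof eventually_elim
      case (elim n)
      show ?case
      proof (rule SUP_least)
        fix \<beta> assume \<beta>: "\<beta> \<in> {\<beta>1..\<beta>2}"
        have "0 < 1 / sqrt (real n)" using elim by (simp add: large_def)
        also have "\<dots> \<le> rate 1 n \<beta>" using \<beta> \<open>0 < \<beta>1\<close> by (intro rate_ge elim) auto
        finally have \<rho>: "0 < rate 1 n \<beta>" .
        have rate: "rate M n \<beta> = M * rate 1 n \<beta>" by (simp add: rate_def)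
        have "inverse (ennreal (rate M n \<beta>)) * (SUP \<theta>0\<in>holder_ball I \<beta> L.
            \<integral>\<^sup>+y. loss I (\<theta>hat n y) \<theta>0 \<partial>white_noise I n \<theta>0)
          \<le> inverse (ennreal (rate M n \<beta>)) * ennreal (C * rate 1 n \<beta>)"
          unfolding C_def using \<beta> \<open>0 < \<beta>1\<close>
          by (intro mult_left_mono SUP_least nn_integral_bayes_loss_le elim bayes) auto
        also have "\<dots> = ennreal (C / M)"
          using M C \<rho> unfolding rate by (simp add: inverse_ennreal ennreal_mult'[symmetric] field_simps)
        finally show "inverse (ennreal (rate M n \<beta>)) * (SUP \<theta>0\<in>holder_ball I \<beta> L.
            \<integral>\<^sup>+y. loss I (\<theta>hat n y) \<theta>0 \<partial>white_noise I n \<theta>0) \<le> ennreal (C / M)" .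
      qed
    qed
  qed
  then have "limsup ?r < \<infinity>"
    by (rule le_less_trans) simp
  ultimately show ?thesis
    using M by blast
qed

end
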